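(* Let $n\ge1$ be an integer, let $1<p\le q<\infty$ and $q\ge2$. Assume $u$ and $w$ are weight functions on $(0,\infty)$, and let $u^o$ be the level function of $u$. If $$\sup_{x>0}\bigg(\int_0^{1/x}u^o\bigg)^{1/q}\bigg(\int_0^x w^{1-p'}\bigg)^{1/p'}<\infty,$$ then there exists a finite constant $C>0$ such that $$\bigg(\int_0^\infty (\hat f)^*(t)^q u(t)\,dt\bigg)^{1/q}\le C\bigg(\int_0^\infty f^*(t)^p w(t)\,dt\bigg)^{1/p}$$ for all $f\in L^1(\mathbb R^n)$.
   Context: A weight function on $(0,\infty)$ is a non-negative measurable function (values in $[0,\infty]$ allowed); no monotonicity is assumed. The level function $u^o$ of $u$ is defined by requiring that $x\mapsto\int_0^x u^o$ is the least concave majorant of $x\mapsto\int_0^x u$ on $(0,\infty)$; if there is no finite concave majorant then $\int_0^x u^o$ is understood to be $\infty$ for every $x>0$. The Fourier transform of $f\in L^1(\mathbb R^n)$ is $\hat f(x)=\int_{\mathbb R^n}e^{-2\pi i x\cdot y}f(y)\,dy$. For a measurable function $f$ on $\mathbb R^n$, with $\mu$ denoting Lebesgue measure, the non-increasing rearrangement is $f^*(t)=\inf\{\alpha>0:\mu_f(\alpha)\le t\}$, $t>0$, where $\mu_f(\alpha)=\mu\{x:|f(x)|>\alpha\}$. Conjugate indices: $1/p+1/p'=1$. Usual conventions: $0\cdot\infty=0$, negative powers of $0$ are $\infty$, negative powers of $\infty$ are $0$. *)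

theory Defs
  imports "HOL-Analysis.Analysis"
begin

text \<open>Real powers on $[0,\infty]$: negative powers of $0$ are $\infty$ and negative powers of
  $\infty$ are $0$. The product on \<^typ>\<open>ennreal\<close> already satisfies $0\cdot\infty = 0$.\<close>

definition epowr :: "ennreal \<Rightarrow> real \<Rightarrow> ennreal" (infixr "epowr" 80) where
  "x epowr a =
     (if a = 0 then 1
      else if x = \<infinity> then (if a > 0 then \<infinity> else 0)
      else if x = 0 \<and> a < 0 then \<infinity>
      else ennreal (enn2real x powr a))"

text \<open>Only the values on $(0,\infty)$ matter; measurability is Lebesgue measurability.\<close>

definition weight :: "(real \<Rightarrow> ennreal) \<Rightarrow> bool" where
  "weight u \<longleftrightarrow> u \<in> borel_measurable (lebesgue_on {0<..})"

definition primitive :: "(real \<Rightarrow> ennreal) \<Rightarrow> real \<Rightarrow> ennreal" where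
  "primitive u x = (\<integral>\<^sup>+t\<in>{0<..<x}. u t \<partial>lebesgue)"

text \<open>Majorants are real-valued, hence finite. The comparison is made in \<^typ>\<open>ereal\<close> because
  \<^const>\<open>ennreal\<close> truncates negative reals to $0$.\<close>

definition concave_majorant :: "(real \<Rightarrow> real) \<Rightarrow> (real \<Rightarrow> ennreal) \<Rightarrow> bool" where
  "concave_majorant G F \<longleftrightarrow>
     concave_on {0<..} G \<and> (\<forall>x>0. enn2ereal (F x) \<le> ereal (G x))"

definition least_concave_majorant :: "(real \<Rightarrow> real) \<Rightarrow> (real \<Rightarrow> ennreal) \<Rightarrow> bool" where
  "least_concave_majorant G F \<longleftrightarrow>
     concave_majorant G F \<and> (\<forall>H. concave_majorant H F \<longrightarrow> (\<forall>x>0. G x \<le> H x))"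

text \<open>A relation rather than an operation, since the level function is determined only up to
  null sets (and, when there is no finite concave majorant, only through its primitive).\<close>

definition level_function :: "(real \<Rightarrow> ennreal) \<Rightarrow> (real \<Rightarrow> ennreal) \<Rightarrow> bool" where
  "level_function u uo \<longleftrightarrow>
     weight uo \<and>
     (if \<exists>H. concave_majorant H (primitive u)
      then \<exists>G. least_concave_majorant G (primitive u) \<and>
               (\<forall>x>0. primitive uo x = ennreal (G x))
      else \<forall>x>0. primitive uo x = \<infinity>)"

definition fourier :: "('a::euclidean_space \<Rightarrow> complex) \<Rightarrow> 'a \<Rightarrow> complex" where
  "fourier f x =
     (LINT y|lebesgue. exp (- 2 * complex_of_real pi * \<i> * complex_of_real (x \<bullet> y)) * f y)"

definition distribution_fun :: "('a::euclidean_space \<Rightarrow> complex) \<Rightarrow> real \<Rightarrow> ennreal" where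
  "distribution_fun f \<alpha> = emeasure lebesgue {x. norm (f x) > \<alpha>}"

definition rearrangement :: "('a::euclidean_space \<Rightarrow> complex) \<Rightarrow> real \<Rightarrow> ennreal" where
  "rearrangement f t = (INF \<alpha>\<in>{\<alpha>::real. \<alpha> > 0 \<and> distribution_fun f \<alpha> \<le> ennreal t}. ennreal \<alpha>)"

end

theory Submission
  imports Defs "HOL-Probability.Characteristic_Functions"
begin

text \<open>Write \<open>F\<close> and \<open>h\<close> for the rearrangements of the Fourier transform and of \<open>f\<close>, and put
  \<open>g(t) = \<integral>\<^sub>0\<^bsup>1/t\<^esup> h\<close>. Splitting \<open>f\<close> at height \<open>h(1/z)\<close> and using \<open>L\<^sup>1 \<rightarrow> L\<^sup>\<infinity>\<close> on the large part and
  Plancherel on the small part gives \<open>\<integral>\<^sub>0\<^sup>z F\<^sup>2 \<le> 6 \<integral>\<^sub>0\<^sup>z g\<^sup>2\<close> for every \<open>z > 0\<close>. Since \<open>q \<ge> 2\<close>, this passes to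
  \<open>\<integral> F\<^sup>q k \<le> C \<integral> g\<^sup>q k\<close> for every decreasing \<open>k\<close>. For \<open>k\<close> take \<open>(P(2t) - P(t)) / t\<close>, where \<open>P\<close> is the
  primitive of the level function: by concavity it is decreasing, and its primitive is
  comparable to \<open>P\<close>, so it can replace the level function throughout. What remains is a
  weighted Hardy inequality for \<open>h \<mapsto> g\<close> with exactly the hypothesis as its condition.\<close>

subsection \<open>Integrals against decreasing functions\<close>

text \<open>The obstacle is that the rearranged Fourier transform \<open>F\<close> is controlled
  only in square mean over initial intervals, and such a comparison can be tested only against
  decreasing functions. Hence \<open>u\<close>, which need not be monotone, is exchanged for a
  decreasing weight before the square means are used. Hence also the role of q \<ge> 2: in F^q k =
  (F^(q-2) k) F^2 the first factor is then decreasing. The level function is accessible only through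
  its primitive. A dyadic difference quotient of that primitive turns concavity into monotonicity
  without differentiating anything, at the price of the fixed factors 2 and 3. If there is no finite
  concave majorant, the constant \<infinity> serves as the decreasing weight. Integrals are taken in
  [0,\<infinity>]. Where a finite value is essential (to split \<open>f\<close> at a height, to
  absorb a term, to find points at which a primitive takes given values), it comes from the
  integrability of \<open>f\<close> or from a truncation.\<close>

text \<open>Superlevel sets of decreasing functions have this shape, so their measurability and the
  integral comparisons below reduce to half-lines.\<close>

lemma downward_closed_real_cases:
  fixes S :: "real set"
  assumes down: "\<And>x y. x \<in> S \<Longrightarrow> y \<le> x \<Longrightarrow> y \<in> S"
  obtains "S = {}" | "S = UNIV" | b where "S = {..<b}" | b where "S = {..b}"
proof (cases "S = {} \<or> \<not> bdd_above S")
  case True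
  then consider "S = {}" | "\<not> bdd_above S" by blast
  then show ?thesis
  proof cases
    case 2
    have "x \<in> S" for x
    proof -
      obtain y where "y \<in> S" "x < y"
        using 2 by (meson bdd_above.I not_le)
      then show ?thesis using down by auto
    qed
    then show ?thesis using that by blast
  qed (use that in blast)
next
  case False
  then have ne: "S \<noteq> {}" and bd: "bdd_above S" by auto
  have lt: "x \<in> S" if "x < Sup S" for x
    using less_cSup_iff[OF ne bd] that down by (meson less_imp_le)
  have le: "x \<le> Sup S" if "x \<in> S" for x
    using cSup_upper[OF that bd] .
  show ?thesis
  proof (cases "Sup S \<in> S")
    case True
    then have "S = {..Sup S}" using le down by auto
    then show ?thesis using that by blast
  next
    case False
    have "S = {..<Sup S}"
    proof safe
      fix x assume "x \<in> S"
      moreover from this False have "x \<noteq> Sup S" by metis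
      ultimately show "x < Sup S" using le[of x] by auto
    qed (use lt in auto)
    then show ?thesis using that by blast
  qed
qed

lemma borel_measurable_antimono_ennreal:
  fixes \<phi> :: "real \<Rightarrow> ennreal"
  assumes "antimono \<phi>"
  shows "\<phi> \<in> borel_measurable borel"
proof (rule borel_measurableI_greater)
  fix c
  have "{x. c < \<phi> x} \<in> sets borel"
  proof (rule downward_closed_real_cases[of "{x. c < \<phi> x}"])
    show "y \<in> {x. c < \<phi> x}" if "x \<in> {x. c < \<phi> x}" "y \<le> x" for x y
      using that antimonoD[OF assms that(2)] by auto
  qed auto
  then show "{x \<in> space borel. c < \<phi> x} \<in> sets borel" by simp
qed

section \<open>Layer-cake formulas and Hardy's lemma\<close>

text \<open>Used in two ways: with \<open>x\<close> a function value it gives the layer-cake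
  representation, and with \<open>x\<close> a value of \<open>distribution_fun\<close> it measures a
  superlevel set of the rearrangement.\<close>

lemma emeasure_lborel_below_ennreal: "emeasure lborel {\<alpha>. 0 < \<alpha> \<and> ennreal \<alpha> < x} = x"
proof (cases x)
  case (real r)
  then have "{\<alpha>. 0 < \<alpha> \<and> ennreal \<alpha> < x} = {0<..<r}"
    by (auto simp: ennreal_less_iff)
  then show ?thesis using real by simp
next
  case top
  then have "{\<alpha>. 0 < \<alpha> \<and> ennreal \<alpha> < x} = {0<..}" by auto
  moreover have le: "ennreal r \<le> emeasure lborel {0::real<..}" if "0 \<le> r" for r :: real
  proof -
    have "emeasure lborel {0<..<r} \<le> emeasure lborel {0::real<..}"
      by (intro emeasure_mono) auto
    then show ?thesis using that by simp
  qed
  have "emeasure lborel {0::real<..} = top"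
  proof (cases "emeasure lborel {0::real<..}")
    case (real s)
    then show ?thesis using le[of "s + 1"] by (simp add: ennreal_le_iff)
  qed simp
  ultimately show ?thesis using top by simp
qed

lemma ennreal_layer_cake: "x = (\<integral>\<^sup>+\<alpha>\<in>{0<..}. indicator {\<alpha>. ennreal \<alpha> < x} \<alpha> \<partial>lborel)"
proof -
  have "(\<integral>\<^sup>+\<alpha>\<in>{0<..}. indicator {\<alpha>. ennreal \<alpha> < x} \<alpha> \<partial>lborel)
      = (\<integral>\<^sup>+\<alpha>. indicator {\<alpha>. 0 < \<alpha> \<and> ennreal \<alpha> < x} \<alpha> \<partial>lborel)"
    by (intro nn_integral_cong) (auto simp: indicator_def)
  also have "\<dots> = emeasure lborel {\<alpha>. 0 < \<alpha> \<and> ennreal \<alpha> < x}"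
    by (rule nn_integral_indicator) simp
  finally show ?thesis by (simp only: emeasure_lborel_below_ennreal)
qed

lemma (in sigma_finite_measure) nn_integral_layer_cake:
  assumes [measurable]: "\<phi> \<in> borel_measurable M" "a \<in> borel_measurable M"
  shows "(\<integral>\<^sup>+x. \<phi> x * a x \<partial>M)
      = (\<integral>\<^sup>+\<alpha>\<in>{0<..}. (\<integral>\<^sup>+x. indicator {x. ennreal \<alpha> < \<phi> x} x * a x \<partial>M) \<partial>lborel)"
proof -
  interpret pair_sigma_finite lborel M ..
  have "(\<integral>\<^sup>+x. \<phi> x * a x \<partial>M)
      = (\<integral>\<^sup>+x. (\<integral>\<^sup>+\<alpha>. indicator {0<..} \<alpha> * (indicator {x. ennreal \<alpha> < \<phi> x} x * a x) \<partial>lborel) \<partial>M)"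
  proof (intro nn_integral_cong)
    fix x
    show "\<phi> x * a x = (\<integral>\<^sup>+\<alpha>. indicator {0<..} \<alpha> * (indicator {x. ennreal \<alpha> < \<phi> x} x * a x) \<partial>lborel)"
      apply (subst ennreal_layer_cake[of "\<phi> x"])
      apply (subst nn_integral_multc[symmetric])
      apply (measurable)
      apply (intro nn_integral_cong)
      apply (auto simp: indicator_def)
      done
  qed
  also have "\<dots> = (\<integral>\<^sup>+\<alpha>. (\<integral>\<^sup>+x. indicator {0<..} \<alpha> * (indicator {x. ennreal \<alpha> < \<phi> x} x * a x) \<partial>M) \<partial>lborel)"
    by (rule Fubini') measurable
  also have "\<dots> = (\<integral>\<^sup>+\<alpha>\<in>{0<..}. (\<integral>\<^sup>+x. indicator {x. ennreal \<alpha> < \<phi> x} x * a x \<partial>M) \<partial>lborel)"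
    by (intro nn_integral_cong) (auto simp: indicator_def)
  finally show ?thesis .
qed

text \<open>Both layer-cake integrands coincide. The two measures may live on different spaces,
  since equimeasurability is needed between Euclidean space and the half-line.\<close>

lemma nn_integral_eq_of_level_sets:
  assumes "sigma_finite_measure M" "sigma_finite_measure N"
    and [measurable]: "f \<in> borel_measurable M" "g \<in> borel_measurable N"
    and eq: "\<And>\<alpha>. 0 < \<alpha> \<Longrightarrow>
      emeasure M {x\<in>space M. ennreal \<alpha> < f x} = emeasure N {x\<in>space N. ennreal \<alpha> < g x}"
  shows "integral\<^sup>N M f = integral\<^sup>N N g"
proof -
  have *: "integral\<^sup>N K h = (\<integral>\<^sup>+\<alpha>\<in>{0<..}. emeasure K {x\<in>space K. ennreal \<alpha> < h x} \<partial>lborel)"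
    if "sigma_finite_measure K" and [measurable]: "h \<in> borel_measurable K" for K :: "'c measure" and h
  proof -
    have "emeasure K {x\<in>space K. ennreal \<alpha> < h x} = (\<integral>\<^sup>+x. indicator {x. ennreal \<alpha> < h x} x * 1 \<partial>K)" for \<alpha>
      by (subst nn_integral_indicator[symmetric]) (auto intro!: nn_integral_cong simp del: nn_integral_indicator simp: indicator_def of_bool_def)
    then show ?thesis
      using sigma_finite_measure.nn_integral_layer_cake[OF that(1), of h "\<lambda>_. 1"] by simp
  qed
  show ?thesis
    unfolding *[OF assms(1,3)] *[OF assms(2,4)] using eq
    by (intro nn_integral_cong) (auto simp: indicator_def)
qed

lemma nn_integral_greaterThan_SUP:
  fixes c :: "real \<Rightarrow> ennreal"
  assumes [measurable]: "c \<in> borel_measurable borel"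
  shows "(\<integral>\<^sup>+t\<in>{a<..}. c t \<partial>lborel) = (SUP n::nat. \<integral>\<^sup>+t\<in>{a<..real n}. c t \<partial>lborel)"
proof -
  have "(\<integral>\<^sup>+t\<in>{a<..}. c t \<partial>lborel) = (\<integral>\<^sup>+t. (SUP n::nat. c t * indicator {a<..real n} t) \<partial>lborel)"
  proof (intro nn_integral_cong antisym SUP_least)
    fix t :: real
    obtain n where n: "t \<le> real n" using real_arch_simple by blast
    show "c t * indicator {a<..} t \<le> (SUP n::nat. c t * indicator {a<..real n} t)"
      using n by (intro SUP_upper2[of n]) (auto simp: indicator_def)
  qed (auto simp: indicator_def)
  also have "\<dots> = (SUP n::nat. \<integral>\<^sup>+t\<in>{a<..real n}. c t \<partial>lborel)"
    by (intro nn_integral_monotone_convergence_SUP) (auto simp: incseq_def le_fun_def indicator_def)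
  finally show ?thesis .
qed

text \<open>Hardy's lemma: \<open>\<phi>\<close> is a superposition of indicators of initial
  half-lines, and on each of them the comparison is the hypothesis.\<close>

lemma nn_integral_antimono_mult_le:
  fixes \<phi> a b :: "real \<Rightarrow> ennreal"
  assumes anti: "antimono \<phi>"
    and [measurable]: "a \<in> borel_measurable borel" "b \<in> borel_measurable borel"
    and le: "\<And>x. 0 < x \<Longrightarrow> (\<integral>\<^sup>+t\<in>{0<..<x}. a t \<partial>lborel) \<le> (\<integral>\<^sup>+t\<in>{0<..<x}. b t \<partial>lborel)"
  shows "(\<integral>\<^sup>+t\<in>{0<..}. \<phi> t * a t \<partial>lborel) \<le> (\<integral>\<^sup>+t\<in>{0<..}. \<phi> t * b t \<partial>lborel)"
proof -
  note [measurable] = borel_measurable_antimono_ennreal[OF anti]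
  have seg: "(\<integral>\<^sup>+t. indicator S t * (a t * indicator {0<..} t) \<partial>lborel)
      \<le> (\<integral>\<^sup>+t. indicator S t * (b t * indicator {0<..} t) \<partial>lborel)"
    if down: "\<And>x y. x \<in> S \<Longrightarrow> y \<le> x \<Longrightarrow> y \<in> S" for S
  proof -
    have bdd: "(\<integral>\<^sup>+t. indicator S t * (a t * indicator {0<..} t) \<partial>lborel)
        \<le> (\<integral>\<^sup>+t. indicator S t * (b t * indicator {0<..} t) \<partial>lborel)"
      if S: "S = {..<x} \<or> S = {..x}" for S :: "real set" and x
    proof -
      have *: "(\<integral>\<^sup>+t. indicator S t * (c t * indicator {0<..} t) \<partial>lborel) = (\<integral>\<^sup>+t\<in>{0<..<x}. c t \<partial>lborel)" 
        for c :: "real \<Rightarrow> ennreal"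
      proof (rule nn_integral_cong_AE)
        show "AE t in lborel. indicator S t * (c t * indicator {0<..} t) = c t * indicator {0<..<x} t"
          using AE_lborel_singleton[of x] by eventually_elim (use S in \<open>auto simp: indicator_def\<close>)
      qed
      show ?thesis
      proof (cases "0 < x")
        case True then show ?thesis unfolding * by (rule le)
      next
        case False then show ?thesis unfolding * by simp
      qed
    qed
    \<comment> \<open>A superlevel set can be the whole line, while the hypothesis speaks of bounded
      intervals; monotone convergence bridges the gap.\<close>
    have UNIV: "(\<integral>\<^sup>+t. indicator UNIV t * (a t * indicator {0<..} t) \<partial>lborel)
        \<le> (\<integral>\<^sup>+t. indicator UNIV t * (b t * indicator {0<..} t) \<partial>lborel)"
    proof -
      have eq: "c t * indicator {0<..real n} t = indicator {..real n} t * (c t * indicator {0<..} t)"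
        for c :: "real \<Rightarrow> ennreal" and n t
        by (auto simp: indicator_def)
      show ?thesis
        unfolding indicator_UNIV mult_1_left nn_integral_greaterThan_SUP[OF assms(2)]
          nn_integral_greaterThan_SUP[OF assms(3)] eq
        by (intro SUP_mono') (use bdd in blast)
    qed
    show ?thesis
      by (rule downward_closed_real_cases[OF down]) (use bdd UNIV in auto)
  qed
  have "(\<integral>\<^sup>+t\<in>{0<..}. \<phi> t * a t \<partial>lborel) = (\<integral>\<^sup>+t. \<phi> t * (a t * indicator {0<..} t) \<partial>lborel)"
    by (simp add: mult.assoc)
  also have "\<dots> \<le> (\<integral>\<^sup>+t. \<phi> t * (b t * indicator {0<..} t) \<partial>lborel)"
    unfolding lborel.nn_integral_layer_cake[of \<phi> "\<lambda>t. a t * indicator {0<..} t", simplified]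
      lborel.nn_integral_layer_cake[of \<phi> "\<lambda>t. b t * indicator {0<..} t", simplified]
  proof (rule nn_integral_mono)
    fix \<alpha> :: real
    have "(\<integral>\<^sup>+t. indicator {t. ennreal \<alpha> < \<phi> t} t * (a t * indicator {0<..} t) \<partial>lborel)
        \<le> (\<integral>\<^sup>+t. indicator {t. ennreal \<alpha> < \<phi> t} t * (b t * indicator {0<..} t) \<partial>lborel)"
      by (rule seg) (auto dest: antimonoD[OF anti] intro: less_le_trans)
    then show "(\<integral>\<^sup>+t. indicator {t. ennreal \<alpha> < \<phi> t} t * (a t * indicator {0<..} t) \<partial>lborel) * indicator {0<..} \<alpha>
        \<le> (\<integral>\<^sup>+t. indicator {t. ennreal \<alpha> < \<phi> t} t * (b t * indicator {0<..} t) \<partial>lborel) * indicator {0<..} \<alpha>"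
      by (rule mult_right_mono) simp
  qed
  also have "\<dots> = (\<integral>\<^sup>+t\<in>{0<..}. \<phi> t * b t \<partial>lborel)"
    by (simp add: mult.assoc)
  finally show ?thesis .
qed

subsection \<open>Plancherel inequality\<close>

definition fourier_kernel :: "'a::euclidean_space \<Rightarrow> 'a \<Rightarrow> complex" where
  "fourier_kernel x y = exp (- 2 * complex_of_real pi * \<i> * complex_of_real (x \<bullet> y))"

lemma norm_fourier_kernel [simp]: "norm (fourier_kernel x y) = 1"
  by (simp add: fourier_kernel_def)

lemma borel_measurable_fourier_kernel [measurable]:
  assumes [measurable]: "f \<in> borel_measurable M" "g \<in> borel_measurable M"
  shows "(\<lambda>x. fourier_kernel (f x) (g x)) \<in> borel_measurable M"
  unfolding fourier_kernel_def
  by (rule borel_measurable_continuous_on[OF _ borel_measurable_times[OF borel_measurable_const]])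
     (auto intro!: continuous_intros)

lemma fourier_eq_lborel:
  assumes [measurable]: "f \<in> borel_measurable borel"
  shows "fourier f x = (LINT y|lborel. fourier_kernel x y * f y)"
  unfolding fourier_def fourier_kernel_def[symmetric] by (rule integral_completion) measurable

lemma borel_measurable_fourier:
  assumes [measurable]: "f \<in> borel_measurable borel"
  shows "fourier f \<in> borel_measurable borel"
proof -
  have eq: "fourier f = (\<lambda>x. LINT y|lborel. fourier_kernel x y * f y)"
    using fourier_eq_lborel[OF assms] by auto
  show ?thesis unfolding eq
    by (rule lborel.borel_measurable_lebesgue_integral) measurable
qed

lemma integrable_fourier_kernel_mult:
  assumes "integrable lborel f"
  shows "integrable lborel (\<lambda>y. fourier_kernel x y * f y)"
proof -
  have [measurable]: "f \<in> borel_measurable borel" using assms by auto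
  show ?thesis
    by (rule Bochner_Integration.integrable_bound[OF assms]) (auto simp: norm_mult)
qed

section \<open>Gaussian weights and their Fourier transforms\<close>

text \<open>This is exp(-s^2 |x|^2 / 2), written as a product over coordinates so that its Fourier
  transform factors.\<close>

definition gauss_weight :: "real \<Rightarrow> 'a::euclidean_space \<Rightarrow> real" where
  "gauss_weight s x = (\<Prod>b\<in>Basis. exp (- (s * (x \<bullet> b))\<^sup>2 / 2))"

lemma borel_measurable_gauss_weight [measurable]: "gauss_weight s \<in> borel_measurable borel"
  unfolding gauss_weight_def by measurable

lemma gauss_weight_nonneg [simp]: "0 \<le> gauss_weight s x"
  unfolding gauss_weight_def by (intro prod_nonneg) auto

text \<open>The Fourier transform of \<open>gauss_weight s\<close>: a centred normal density whose
  standard deviation in each coordinate is s / (2 pi).\<close>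

definition gauss_density :: "real \<Rightarrow> 'a::euclidean_space \<Rightarrow> real" where
  "gauss_density s x = (\<Prod>b\<in>Basis. normal_density 0 (s / (2 * pi)) (x \<bullet> b))"

lemma borel_measurable_gauss_density [measurable]: "gauss_density s \<in> borel_measurable borel"
  unfolding gauss_density_def by measurable

lemma gauss_density_nonneg [simp]: "0 \<le> gauss_density s x"
  unfolding gauss_density_def by (intro prod_nonneg) auto

lemma gauss_density_swap: "gauss_density s (y - z) = gauss_density s (z - y)"
  unfolding gauss_density_def normal_density_def by (auto simp: inner_diff_left power2_commute)

text \<open>The dilation x -> s x reduces the integral to the characteristic function of the
  standard normal law at -2 pi t / s; the 2 pi of the Fourier kernel thus ends up in the standard
  deviation.\<close>

lemma fourier_gauss_1d:
  fixes s t :: real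
  assumes s: "0 < s"
  shows "integrable lborel (\<lambda>x. fourier_kernel x t * complex_of_real (exp (- (s * x)\<^sup>2 / 2)))"
    and "(LINT x|lborel. fourier_kernel x t * complex_of_real (exp (- (s * x)\<^sup>2 / 2)))
       = complex_of_real (normal_density 0 (s / (2 * pi)) t)"
proof -
  let ?f = "\<lambda>x. iexp (- (2 * pi * t / s) * x) * complex_of_real (std_normal_density x)"
  have int: "integrable lborel ?f"
  proof (rule Bochner_Integration.integrable_bound[OF integrable_normal_density[of 1 0]])
    show "?f \<in> borel_measurable lborel" by measurable
  qed (auto simp: norm_mult normal_density_nonneg)
  have val: "integral\<^sup>L lborel ?f = complex_of_real (exp (- (2 * pi * t / s)\<^sup>2 / 2))"
  proof -
    have "char std_normal_distribution (- (2 * pi * t / s)) = complex_of_real (exp (- (2 * pi * t / s)\<^sup>2 / 2))"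
      using fun_cong[OF char_std_normal_distribution, of "- (2 * pi * t / s)"] by (simp only: power2_minus)
    then show ?thesis unfolding char_def
      by (subst (asm) integral_density) (auto simp: normal_density_nonneg scaleR_conv_of_real mult.commute)
  qed
  have eq: "?f (0 + s * x) = complex_of_real (1 / sqrt (2 * pi)) * (fourier_kernel x t * complex_of_real (exp (- (s * x)\<^sup>2 / 2)))" for x
    using s unfolding fourier_kernel_def std_normal_density_def by (auto simp: field_simps)
  have integrable_mult_right_imp: "integrable lborel h" if "integrable lborel (\<lambda>x. c * h x)" "c \<noteq> 0"
    for c :: complex and h :: "real \<Rightarrow> complex"
    using integrable_mult_right[OF that(1), of "1 / c"] that(2) by simp
  have i1: "integrable lborel (\<lambda>x. ?f (0 + s * x))"
    using s by (intro lborel_integrable_real_affine int) auto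
  show "integrable lborel (\<lambda>x. fourier_kernel x t * complex_of_real (exp (- (s * x)\<^sup>2 / 2)))"
    using i1 unfolding eq by (rule integrable_mult_right_imp) simp
  have "integral\<^sup>L lborel ?f = \<bar>s\<bar> *\<^sub>R (LINT x|lborel. ?f (0 + s * x))"
    using s by (intro lborel_integral_real_affine) auto
  also have "(LINT x|lborel. ?f (0 + s * x)) = complex_of_real (1 / sqrt (2 * pi)) *
      (LINT x|lborel. fourier_kernel x t * complex_of_real (exp (- (s * x)\<^sup>2 / 2)))"
    unfolding eq by (rule integral_mult_right_zero)
  finally have *: "complex_of_real (exp (- (2 * pi * t / s)\<^sup>2 / 2)) = complex_of_real (s / sqrt (2 * pi)) *
      (LINT x|lborel. fourier_kernel x t * complex_of_real (exp (- (s * x)\<^sup>2 / 2)))"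
    unfolding val using s by (simp add: scaleR_conv_of_real)
  have "normal_density 0 (s / (2 * pi)) t = sqrt (2 * pi) / s * exp (- (2 * pi * t / s)\<^sup>2 / 2)"
  proof -
    have "2 * pi * (s / (2 * pi))\<^sup>2 = s\<^sup>2 / (2 * pi)" by (simp add: power2_eq_square field_simps)
    then have "sqrt (2 * pi * (s / (2 * pi))\<^sup>2) = s / sqrt (2 * pi)"
      using s by (simp add: real_sqrt_divide)
    moreover have "- (t - 0)\<^sup>2 / (2 * (s / (2 * pi))\<^sup>2) = - (2 * pi * t / s)\<^sup>2 / 2"
      using s by (simp add: power2_eq_square field_simps)
    ultimately show ?thesis unfolding normal_density_def by simp
  qed
  then show "(LINT x|lborel. fourier_kernel x t * complex_of_real (exp (- (s * x)\<^sup>2 / 2)))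
       = complex_of_real (normal_density 0 (s / (2 * pi)) t)"
  proof -
    assume nd: "normal_density 0 (s / (2 * pi)) t = sqrt (2 * pi) / s * exp (- (2 * pi * t / s)\<^sup>2 / 2)"
    have "complex_of_real (normal_density 0 (s / (2 * pi)) t)
        = complex_of_real (sqrt (2 * pi) / s) * complex_of_real (exp (- (2 * pi * t / s)\<^sup>2 / 2))"
      unfolding nd by simp
    also have "\<dots> = complex_of_real (sqrt (2 * pi) / s * (s / sqrt (2 * pi))) *
        (LINT x|lborel. fourier_kernel x t * complex_of_real (exp (- (s * x)\<^sup>2 / 2)))"
      unfolding * by (simp only: of_real_mult mult.assoc)
    also have "sqrt (2 * pi) / s * (s / sqrt (2 * pi)) = 1" using s by simp
    finally show ?thesis by simp
  qed
qed

text \<open>\<open>lborel\<close> is the image of the product measure over \<open>Basis\<close>, so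
  Fubini splits the integral coordinate by coordinate.\<close>

lemma lborel_prod_Basis:
  fixes f :: "'a::euclidean_space \<Rightarrow> real \<Rightarrow> complex"
  assumes int: "\<And>b. b \<in> Basis \<Longrightarrow> integrable lborel (f b)"
  shows "integrable lborel (\<lambda>x. \<Prod>b\<in>Basis. f b (x \<bullet> b))"
    and "(LINT x|lborel. (\<Prod>b\<in>Basis. f b (x \<bullet> b))) = (\<Prod>b\<in>Basis. integral\<^sup>L lborel (f b))"
proof -
  interpret product_sigma_finite "\<lambda>_::'a. lborel :: real measure" ..
  have [measurable]: "\<And>b. b \<in> Basis \<Longrightarrow> f b \<in> borel_measurable borel"
    using int by (auto dest: borel_measurable_integrable)
  have eq: "(\<Prod>b\<in>Basis. f b ((\<Sum>b\<in>Basis. x b *\<^sub>R b) \<bullet> b)) = (\<Prod>b\<in>Basis. f b (x b))" for x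
    by (intro prod.cong) auto
  have m: "(\<lambda>x. \<Prod>b\<in>Basis. f b (x \<bullet> b)) \<in> borel_measurable borel" by measurable
  have m2: "(\<lambda>f. \<Sum>b\<in>Basis. f b *\<^sub>R b :: 'a) \<in> (\<Pi>\<^sub>M b\<in>Basis. lborel) \<rightarrow>\<^sub>M borel" by measurable
  show "integrable lborel (\<lambda>x. \<Prod>b\<in>Basis. f b (x \<bullet> b))"
    unfolding lborel_eq[where 'a='a]
    by (subst integrable_distr_eq[OF m2 m]) (unfold eq, intro product_integrable_prod, auto intro: int)
  show "(LINT x|lborel. (\<Prod>b\<in>Basis. f b (x \<bullet> b))) = (\<Prod>b\<in>Basis. integral\<^sup>L lborel (f b))"
    unfolding lborel_eq[where 'a='a]
    by (subst integral_distr[OF m2 m]) (unfold eq, intro product_integral_prod, auto intro: int)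
qed

lemma fourier_gauss:
  fixes t :: "'a::euclidean_space"
  assumes s: "0 < s"
  shows "integrable lborel (\<lambda>x. fourier_kernel x t * complex_of_real (gauss_weight s x))"
    and "(LINT x|lborel. fourier_kernel x t * complex_of_real (gauss_weight s x))
       = complex_of_real (gauss_density s t)"
proof -
  have ker: "fourier_kernel x t = (\<Prod>b\<in>Basis. fourier_kernel (x \<bullet> b) (t \<bullet> b))" for x
    unfolding fourier_kernel_def by (subst euclidean_inner) (simp add: exp_sum[symmetric] sum_distrib_left)
  have eq: "fourier_kernel x t * complex_of_real (gauss_weight s x) =
    (\<Prod>b\<in>Basis. fourier_kernel (x \<bullet> b) (t \<bullet> b) * complex_of_real (exp (- (s * (x \<bullet> b))\<^sup>2 / 2)))" for x
    unfolding ker gauss_weight_def of_real_prod prod.distrib ..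
  show "integrable lborel (\<lambda>x. fourier_kernel x t * complex_of_real (gauss_weight s x))"
    unfolding eq by (rule lborel_prod_Basis(1)) (rule fourier_gauss_1d[OF s])
  show "(LINT x|lborel. fourier_kernel x t * complex_of_real (gauss_weight s x))
       = complex_of_real (gauss_density s t)"
    unfolding eq gauss_density_def of_real_prod
    by (subst lborel_prod_Basis(2), rule fourier_gauss_1d[OF s]) (rule prod.cong[OF refl], rule fourier_gauss_1d[OF s])
qed

text \<open>The shift by \<open>y\<close> only moves the mean of each coordinate, so the integrand
  remains a product of normal probability densities.\<close>

lemma nn_integral_gauss_density:
  fixes y :: "'a::euclidean_space"
  assumes s: "0 < s"
  shows "(\<integral>\<^sup>+z. gauss_density s (z - y) \<partial>lborel) = 1"
proof -
  have "(\<integral>\<^sup>+z. gauss_density s (z - y) \<partial>lborel)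
    = (\<integral>\<^sup>+z. (\<Prod>b\<in>Basis. ennreal (normal_density (y \<bullet> b) (s / (2 * pi)) (z \<bullet> b))) \<partial>lborel)"
    unfolding gauss_density_def
    by (intro nn_integral_cong) (auto simp: prod_ennreal normal_density_def inner_diff_left)
  also have "\<dots> = (\<Prod>b\<in>Basis. (\<integral>\<^sup>+z. ennreal (normal_density (y \<bullet> b) (s / (2 * pi)) z) \<partial>lborel))"
    by (rule nn_integral_lborel_prod) auto
  also have "\<dots> = 1"
    using s by (intro prod.neutral ballI, subst nn_integral_eq_integral) auto
  finally show ?thesis .
qed

lemma borel_measurable_cnj [measurable (raw)]:
  "f \<in> borel_measurable M \<Longrightarrow> (\<lambda>x. cnj (f x)) \<in> borel_measurable M"
  by (rule borel_measurable_continuous_on[where f=cnj]) (auto intro!: continuous_intros)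

lemma integrable_mult_cnj_pair:
  fixes g :: "'a::euclidean_space \<Rightarrow> complex"
  assumes g: "integrable lborel g"
  shows "integrable (lborel \<Otimes>\<^sub>M lborel) (\<lambda>p. g (fst p) * cnj (g (snd p)))"
proof (rule lborel_pair.Fubini_integrable)
  have [measurable]: "g \<in> borel_measurable borel" using g by auto
  show "(\<lambda>p. g (fst p) * cnj (g (snd p))) \<in> borel_measurable (lborel \<Otimes>\<^sub>M lborel)" by measurable
  show "integrable lborel (\<lambda>x. LINT y|lborel. norm (g (fst (x, y)) * cnj (g (snd (x, y)))))"
    using g by (simp add: norm_mult)
  have "integrable lborel (\<lambda>y. cnj (g y))" using g by (rule integrable_cnj)
  then show "AE x in lborel. integrable lborel (\<lambda>y. g (fst (x, y)) * cnj (g (snd (x, y))))"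
    by (intro AE_I2) simp
qed

text \<open>By Fubini the left-hand side is a quadratic form in \<open>f\<close> whose kernel is a Gaussian
  probability density in \<open>y - z\<close>; Schur's test bounds it uniformly in \<open>s\<close>.\<close>

lemma fourier_weighted_Plancherel_le:
  fixes f :: "'a::euclidean_space \<Rightarrow> complex"
  assumes f: "integrable lborel f" and s: "0 < s"
  shows "(\<integral>\<^sup>+x. ennreal ((norm (fourier f x))\<^sup>2 * gauss_weight s x) \<partial>lborel)
    \<le> (\<integral>\<^sup>+x. ennreal ((norm (f x))\<^sup>2) \<partial>lborel)"
proof -
  have fm [measurable]: "f \<in> borel_measurable borel" using f by auto
  note [measurable] = borel_measurable_fourier[OF fm]
  interpret Q: pair_sigma_finite "lborel :: 'a measure" "lborel \<Otimes>\<^sub>M lborel :: ('a \<times> 'a) measure" ..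
  \<comment> \<open>Expanding the squared modulus of the transform as a double integral over p = (y,
    z) gives this integrand, because the kernel at y - z is the kernel at y times the conjugate of
    the kernel at z. The Gaussian factor makes it integrable in all three variables, which justifies
    Fubini.\<close>
  define \<Phi> where "\<Phi> x p = fourier_kernel x (fst p - snd p) * complex_of_real (gauss_weight s x) * (f (fst p) * cnj (f (snd p)))"
    for x and p :: "'a \<times> 'a"
  have \<Phi>m [measurable]: "case_prod \<Phi> \<in> borel_measurable (lborel \<Otimes>\<^sub>M (lborel \<Otimes>\<^sub>M lborel))"
    unfolding \<Phi>_def by measurable
  have ff: "integrable (lborel \<Otimes>\<^sub>M lborel) (\<lambda>p. f (fst p) * cnj (f (snd p)))"
    by (rule integrable_mult_cnj_pair[OF f])
  have w: "integrable lborel (\<lambda>x::'a. gauss_weight s x)"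
    using integrable_norm[OF fourier_gauss(1)[OF s, of 0]] by (simp add: norm_mult)
  have \<Phi>i: "integrable (lborel \<Otimes>\<^sub>M (lborel \<Otimes>\<^sub>M lborel)) (case_prod \<Phi>)"
  proof (rule Q.Fubini_integrable[OF \<Phi>m])
    have n: "norm (\<Phi> x p) = gauss_weight s x * norm (f (fst p) * cnj (f (snd p)))" for x p
      unfolding \<Phi>_def by (simp add: norm_mult)
    show "integrable lborel (\<lambda>x. LINT p|(lborel \<Otimes>\<^sub>M lborel). norm (case (x, p) of (x, p) \<Rightarrow> \<Phi> x p))"
      using w by (simp add: n)
    show "AE x in lborel. integrable (lborel \<Otimes>\<^sub>M lborel) (\<lambda>p. case (x, p) of (x, p) \<Rightarrow> \<Phi> x p)"
    proof (rule AE_I2)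
      fix x :: 'a
      have "integrable (lborel \<Otimes>\<^sub>M lborel) (\<lambda>p. gauss_weight s x * norm (f (fst p) * cnj (f (snd p))))"
        using ff by (intro integrable_mult_right integrable_norm)
      then show "integrable (lborel \<Otimes>\<^sub>M lborel) (\<lambda>p. case (x, p) of (x, p) \<Rightarrow> \<Phi> x p)"
        by (rule Bochner_Integration.integrable_bound) (auto simp: n)
    qed
  qed
  have inner: "(LINT p|(lborel \<Otimes>\<^sub>M lborel). \<Phi> x p) = complex_of_real ((norm (fourier f x))\<^sup>2 * gauss_weight s x)" for x
  proof -
    let ?g = "\<lambda>y. fourier_kernel x y * f y"
    have g: "integrable lborel ?g" by (rule integrable_fourier_kernel_mult[OF f])
    have k: "fourier_kernel x (y - z) = fourier_kernel x y * cnj (fourier_kernel x z)" for y z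
      unfolding fourier_kernel_def exp_cnj
      by (simp add: exp_add[symmetric] inner_diff_right algebra_simps)
    have eq: "\<Phi> x p = complex_of_real (gauss_weight s x) * (?g (fst p) * cnj (?g (snd p)))" for p
      unfolding \<Phi>_def k by simp
    have gg: "integrable (lborel \<Otimes>\<^sub>M lborel) (\<lambda>p. ?g (fst p) * cnj (?g (snd p)))"
      by (rule integrable_mult_cnj_pair[OF g])
    have "(LINT p|(lborel \<Otimes>\<^sub>M lborel). ?g (fst p) * cnj (?g (snd p))) = (LINT y|lborel. LINT z|lborel. ?g y * cnj (?g z))"
      using lborel_pair.integral_fst'[OF gg] by simp
    also have "\<dots> = fourier f x * cnj (fourier f x)"
      unfolding fourier_eq_lborel[OF fm]
      by (simp only: integral_mult_right_zero integral_mult_left_zero Bochner_Integration.integral_cnj)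
    finally show "(LINT p|(lborel \<Otimes>\<^sub>M lborel). \<Phi> x p) = complex_of_real ((norm (fourier f x))\<^sup>2 * gauss_weight s x)"
      unfolding eq integral_mult_right_zero of_real_mult complex_norm_square by (simp only: mult.commute)
  qed
  have outer: "(LINT x|lborel. \<Phi> x p) = complex_of_real (gauss_density s (fst p - snd p)) * (f (fst p) * cnj (f (snd p)))" for p
    unfolding \<Phi>_def using fourier_gauss(2)[OF s, of "fst p - snd p"] by (simp only: integral_mult_left_zero)
  have I1: "integrable lborel (\<lambda>x. (norm (fourier f x))\<^sup>2 * gauss_weight s x)"
    using Q.integrable_fst'[OF \<Phi>i] unfolding prod.case inner complex_of_real_integrable_eq .
  have "ennreal (LINT x|lborel. (norm (fourier f x))\<^sup>2 * gauss_weight s x)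
      \<le> ennreal (norm (LINT x|lborel. complex_of_real ((norm (fourier f x))\<^sup>2 * gauss_weight s x)))"
    unfolding integral_complex_of_real norm_of_real by (intro ennreal_leI) simp
  also have "(LINT x|lborel. complex_of_real ((norm (fourier f x))\<^sup>2 * gauss_weight s x))
      = (LINT p|(lborel \<Otimes>\<^sub>M lborel). LINT x|lborel. \<Phi> x p)"
    unfolding inner[symmetric] by (rule Q.Fubini_integral[OF \<Phi>i, symmetric])
  \<comment> \<open>If the function of \<open>p\<close> were not integrable, its Bochner integral
    would be 0 by convention, so the bound holds in both cases.\<close>
  also have "ennreal (norm \<dots>) \<le> (\<integral>\<^sup>+p. norm (LINT x|lborel. \<Phi> x p) \<partial>(lborel \<Otimes>\<^sub>M lborel))"
    unfolding inner
    by (cases "integrable (lborel \<Otimes>\<^sub>M lborel) (\<lambda>p. LINT x|lborel. \<Phi> x p)")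
      (auto intro: integral_norm_bound_ennreal simp: not_integrable_integral_eq)
  also have "\<dots> = (\<integral>\<^sup>+y. \<integral>\<^sup>+z. ennreal (gauss_density s (y - z) * (norm (f y) * norm (f z))) \<partial>lborel \<partial>lborel)"
    unfolding outer by (subst lborel.nn_integral_fst[symmetric]) (auto simp: norm_mult)
  \<comment> \<open>Schur's test: |f y| |f z| is at most the mean of the two squares. In each half
    the variable absent from \<open>f\<close> is integrated against the density, which has total
    mass 1; symmetry of the density puts the first half into that form.\<close>
  also have "\<dots> \<le> (\<integral>\<^sup>+y. \<integral>\<^sup>+z. (ennreal (gauss_density s (z - y)) * ennreal ((norm (f y))\<^sup>2 / 2)
        + ennreal (gauss_density s (y - z)) * ennreal ((norm (f z))\<^sup>2 / 2)) \<partial>lborel \<partial>lborel)"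
  proof (intro nn_integral_mono)
    fix y z
    have "norm (f y) * norm (f z) \<le> (norm (f y))\<^sup>2 / 2 + (norm (f z))\<^sup>2 / 2"
      using sum_squares_bound[of "norm (f y)" "norm (f z)"] by simp
    then have "gauss_density s (y - z) * (norm (f y) * norm (f z)) \<le> gauss_density s (y - z) * ((norm (f y))\<^sup>2 / 2 + (norm (f z))\<^sup>2 / 2)"
      by (rule mult_left_mono) simp
    then show "ennreal (gauss_density s (y - z) * (norm (f y) * norm (f z))) \<le> ennreal (gauss_density s (z - y)) * ennreal ((norm (f y))\<^sup>2 / 2)
        + ennreal (gauss_density s (y - z)) * ennreal ((norm (f z))\<^sup>2 / 2)"
      by (subst gauss_density_swap) (simp add: ennreal_mult[symmetric] ennreal_plus[symmetric] algebra_simps gauss_density_swap[of s z y] del: ennreal_plus)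
  qed
  also have "\<dots> = (\<integral>\<^sup>+y. \<integral>\<^sup>+z. ennreal (gauss_density s (z - y)) * ennreal ((norm (f y))\<^sup>2 / 2) \<partial>lborel \<partial>lborel)
        + (\<integral>\<^sup>+y. \<integral>\<^sup>+z. ennreal (gauss_density s (y - z)) * ennreal ((norm (f z))\<^sup>2 / 2) \<partial>lborel \<partial>lborel)"
    by (simp add: nn_integral_add)
  also have "(\<integral>\<^sup>+y. \<integral>\<^sup>+z. ennreal (gauss_density s (y - z)) * ennreal ((norm (f z))\<^sup>2 / 2) \<partial>lborel \<partial>lborel)
    = (\<integral>\<^sup>+z. \<integral>\<^sup>+y. ennreal (gauss_density s (y - z)) * ennreal ((norm (f z))\<^sup>2 / 2) \<partial>lborel \<partial>lborel)"
    by (rule lborel_pair.Fubini') measurable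
  also have "(\<integral>\<^sup>+y. \<integral>\<^sup>+z. ennreal (gauss_density s (z - y)) * ennreal ((norm (f y))\<^sup>2 / 2) \<partial>lborel \<partial>lborel)
     + (\<integral>\<^sup>+z. \<integral>\<^sup>+y. ennreal (gauss_density s (y - z)) * ennreal ((norm (f z))\<^sup>2 / 2) \<partial>lborel \<partial>lborel)
     = (\<integral>\<^sup>+y. ennreal ((norm (f y))\<^sup>2) \<partial>lborel)"
    by (simp add: nn_integral_multc nn_integral_gauss_density[OF s] nn_integral_add[symmetric] ennreal_plus[symmetric] del: ennreal_plus)
  finally show ?thesis
    using I1 by (subst nn_integral_eq_integral) auto
qed

text \<open>Fatou's lemma with s = 1/(n+1): the Gaussian weights tend to 1 pointwise, and the
  weighted bound is independent of \<open>s\<close>.\<close>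

lemma fourier_Plancherel_le:
  fixes f :: "'a::euclidean_space \<Rightarrow> complex"
  assumes f: "integrable lborel f"
  shows "(\<integral>\<^sup>+x. ennreal ((norm (fourier f x))\<^sup>2) \<partial>lborel) \<le> (\<integral>\<^sup>+x. ennreal ((norm (f x))\<^sup>2) \<partial>lborel)"
proof -
  have fm [measurable]: "f \<in> borel_measurable borel" using f by auto
  note [measurable] = borel_measurable_fourier[OF fm]
  define u where "u n x = ennreal ((norm (fourier f x))\<^sup>2 * gauss_weight (1 / Suc n) x)" for n :: nat and x
  have "u n \<in> borel_measurable lborel" for n unfolding u_def by measurable
  then have "(\<integral>\<^sup>+x. liminf (\<lambda>n. u n x) \<partial>lborel) \<le> liminf (\<lambda>n. integral\<^sup>N lborel (u n))"
    by (rule nn_integral_liminf)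
  also have "liminf (\<lambda>n. integral\<^sup>N lborel (u n)) \<le> (\<integral>\<^sup>+x. ennreal ((norm (f x))\<^sup>2) \<partial>lborel)"
    unfolding u_def
    by (intro Liminf_le always_eventually allI fourier_weighted_Plancherel_le[OF f]) auto
  also have "(\<lambda>x. liminf (\<lambda>n. u n x)) = (\<lambda>x. ennreal ((norm (fourier f x))\<^sup>2))"
  proof (rule ext)
    fix x
    show "liminf (\<lambda>n. u n x) = ennreal ((norm (fourier f x))\<^sup>2)"
    proof (rule lim_imp_Liminf)
    have "(\<lambda>n. gauss_weight (1 / Suc n) x) \<longlonglongrightarrow> (\<Prod>b\<in>Basis. exp (- (0 * (x \<bullet> b))\<^sup>2 / 2))"
      unfolding gauss_weight_def
      by (intro tendsto_intros LIMSEQ_Suc[OF lim_1_over_n]) auto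
    then have "(\<lambda>n. gauss_weight (1 / Suc n) x) \<longlonglongrightarrow> 1" by simp
    from tendsto_mult[OF tendsto_const this, of "(norm (fourier f x))\<^sup>2"]
    show "(\<lambda>n. u n x) \<longlonglongrightarrow> ennreal ((norm (fourier f x))\<^sup>2)"
      unfolding u_def by (intro tendsto_ennrealI) simp
    qed simp
  qed
  finally show ?thesis .
qed

subsection \<open>Non-increasing rearrangements\<close>

lemma rearrangement_le:
  "0 < \<alpha> \<Longrightarrow> distribution_fun f \<alpha> \<le> ennreal t \<Longrightarrow> rearrangement f t \<le> ennreal \<alpha>"
  unfolding rearrangement_def by (rule INF_lower) auto

lemma antimono_rearrangement: "antimono (rearrangement f)"
proof (rule antimonoI)
  fix s t :: real assume "s \<le> t"
  then show "rearrangement f t \<le> rearrangement f s"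
    unfolding rearrangement_def
    by (intro INF_superset_mono) (auto intro: order_trans ennreal_leI)
qed

lemma borel_measurable_rearrangement [measurable]: "rearrangement f \<in> borel_measurable borel"
  by (rule borel_measurable_antimono_ennreal[OF antimono_rearrangement])

lemma distribution_fun_lborel:
  assumes [measurable]: "f \<in> borel_measurable borel"
  shows "distribution_fun f \<alpha> = emeasure lborel {x. \<alpha> < norm (f x)}"
  unfolding distribution_fun_def by simp

lemma distribution_fun_mono:
  assumes [measurable]: "h \<in> borel_measurable borel"
    and "\<And>x. \<alpha> < norm (g x) \<Longrightarrow> \<beta> < norm (h x)"
  shows "distribution_fun g \<alpha> \<le> distribution_fun h \<beta>"
proof -
  have "{x. \<beta> < norm (h x)} \<in> sets borel" by measurable
  then show ?thesis unfolding distribution_fun_def using assms(2)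
    by (intro emeasure_mono) auto
qed

text \<open>The distribution function is right-continuous: {|f| > \<alpha>} is the increasing union
  of the sets {|f| > \<alpha> + 1/(n+1)}, so a strict inequality at \<alpha> persists slightly above
  \<alpha>. This makes the description of superlevel sets exact, even at jumps.\<close>

lemma less_rearrangement_iff:
  assumes [measurable]: "f \<in> borel_measurable borel" and \<alpha>: "0 \<le> \<alpha>"
  shows "ennreal \<alpha> < rearrangement f t \<longleftrightarrow> ennreal t < distribution_fun f \<alpha>"
proof
  assume less: "ennreal \<alpha> < rearrangement f t"
  show "ennreal t < distribution_fun f \<alpha>"
  proof (rule ccontr)
    assume "\<not> ?thesis"
    then have le: "distribution_fun f \<alpha> \<le> ennreal t" by simp
    have b: "rearrangement f t \<le> ennreal \<beta>" if "\<alpha> < \<beta>" for \<beta>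
    proof (rule rearrangement_le)
      have "distribution_fun f \<beta> \<le> distribution_fun f \<alpha>"
        by (rule distribution_fun_mono) (use that in auto)
      then show "distribution_fun f \<beta> \<le> ennreal t" using le by (rule order_trans)
    qed (use that \<alpha> in auto)
    have e: "rearrangement f t \<le> ennreal \<alpha> + ennreal e" if "0 < e" for e
      using b[of "\<alpha> + e"] that \<alpha> by (simp add: ennreal_plus)
    have "rearrangement f t \<le> ennreal \<alpha>" by (rule ennreal_le_epsilon) (rule e)
    with less show False by simp
  qed
next
  assume less: "ennreal t < distribution_fun f \<alpha>"
  define S where "S n = {x. \<alpha> + 1 / Suc n < norm (f x)}" for n
  have "{x. \<alpha> < norm (f x)} = (\<Union>n. S n)"
  proof safe
    fix x assume "\<alpha> < norm (f x)"
    then obtain n where "1 / real (Suc n) < norm (f x) - \<alpha>"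
      using reals_Archimedean[of "norm (f x) - \<alpha>"] by (auto simp: inverse_eq_divide)
    then show "x \<in> (\<Union>n. S n)" unfolding S_def by (auto intro!: exI[of _ n])
  next
    fix x n assume "x \<in> S n"
    moreover have "0 < 1 / real (Suc n)" by simp
    ultimately show "\<alpha> < norm (f x)" unfolding S_def mem_Collect_eq by linarith
  qed
  then have sup: "distribution_fun f \<alpha> = (SUP n. emeasure lborel (S n))"
    unfolding distribution_fun_lborel[OF assms(1)]
  proof (subst SUP_emeasure_incseq)
    show "range S \<subseteq> sets lborel" unfolding S_def by (intro image_subsetI) measurable
    show "incseq S" unfolding S_def incseq_def
    proof safe
      fix m n :: nat and x assume "m \<le> n" "\<alpha> + 1 / real (Suc m) < norm (f x)"
      moreover have "1 / real (Suc n) \<le> 1 / real (Suc m)" using \<open>m \<le> n\<close> by (simp add: frac_le)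
      ultimately show "\<alpha> + 1 / real (Suc n) < norm (f x)" by linarith
    qed
  qed simp
  obtain n where "ennreal t < emeasure lborel (S n)"
    using less unfolding sup less_SUP_iff by blast
  then have n: "ennreal t < distribution_fun f (\<alpha> + 1 / Suc n)"
    unfolding distribution_fun_lborel[OF assms(1)] S_def .
  have "ennreal (\<alpha> + 1 / Suc n) \<le> rearrangement f t"
    unfolding rearrangement_def
  proof (intro INF_greatest ennreal_leI)
    fix \<beta> assume "\<beta> \<in> {\<alpha>. 0 < \<alpha> \<and> distribution_fun f \<alpha> \<le> ennreal t}"
    then have "\<not> distribution_fun f (\<alpha> + 1 / Suc n) \<le> distribution_fun f \<beta>"
      using n by auto
    then show "\<alpha> + 1 / Suc n \<le> \<beta>"
      by (rule contrapos_np) (intro distribution_fun_mono, auto)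
  qed
  moreover have "ennreal \<alpha> < ennreal (\<alpha> + 1 / Suc n)"
    using \<alpha> by (intro ennreal_lessI) (auto intro: add_nonneg_pos)
  ultimately show "ennreal \<alpha> < rearrangement f t" by (rule less_le_trans[rotated])
qed

text \<open>The condition \<open>lev\<close> says that each superlevel set of \<Phi> at positive
  height is a ray (\<beta>, \<infinity>] with finite \<beta> \<ge> 0, or empty; in particular \<Phi>
  vanishes at 0. For a ray, the superlevel sets on both sides have measure
  \<open>distribution_fun f \<beta>\<close>.\<close>

lemma nn_integral_rearrangement:
  assumes [measurable]: "f \<in> borel_measurable borel" "\<Phi> \<in> borel_measurable borel"
    and lev: "\<And>\<alpha>. 0 < \<alpha> \<Longrightarrow> (\<exists>\<beta>\<ge>0. \<forall>r. ennreal \<alpha> < \<Phi> r \<longleftrightarrow> ennreal \<beta> < r) \<or> (\<forall>r. \<Phi> r \<le> ennreal \<alpha>)"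
  shows "(\<integral>\<^sup>+x. \<Phi> (ennreal (norm (f x))) \<partial>lborel) = (\<integral>\<^sup>+t\<in>{0<..}. \<Phi> (rearrangement f t) \<partial>lborel)"
proof (rule nn_integral_eq_of_level_sets)
  fix \<alpha> :: real assume "0 < \<alpha>"
  from lev[OF this] consider \<beta> where "0 \<le> \<beta>" "\<And>r. ennreal \<alpha> < \<Phi> r \<longleftrightarrow> ennreal \<beta> < r"
    | "\<And>r. \<not> ennreal \<alpha> < \<Phi> r" by (auto simp: not_less)
  then show "emeasure lborel {x \<in> space lborel. ennreal \<alpha> < \<Phi> (ennreal (norm (f x)))}
    = emeasure lborel {t \<in> space lborel. ennreal \<alpha> < \<Phi> (rearrangement f t) * indicator {0<..} t}"
  proof cases
    case 1
    have "{x \<in> space lborel. ennreal \<alpha> < \<Phi> (ennreal (norm (f x)))} = {x. \<beta> < norm (f x)}"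
      using 1 by (auto simp: ennreal_less_iff)
    moreover have "{t \<in> space lborel. ennreal \<alpha> < \<Phi> (rearrangement f t) * indicator {0<..} t}
        = {t. 0 < t \<and> ennreal t < distribution_fun f \<beta>}"
      using 1 less_rearrangement_iff[OF assms(1) \<open>0 \<le> \<beta>\<close>] by (auto simp: indicator_def split: if_splits)
    ultimately show ?thesis
      by (simp only: emeasure_lborel_below_ennreal distribution_fun_lborel[OF assms(1)])
  next
    case 2
    then have "{t \<in> space lborel. ennreal \<alpha> < \<Phi> (rearrangement f t) * indicator {0<..} t} = {}"
      by (auto simp: indicator_def split: if_splits)
    then show ?thesis using 2 by simp
  qed
qed (measurable, auto intro: lborel.sigma_finite_measure_axioms)

lemma nn_integral_rearrangement_diff:
  assumes [measurable]: "f \<in> borel_measurable borel" and "0 \<le> l"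
  shows "(\<integral>\<^sup>+x. (ennreal (norm (f x)) - ennreal l) \<partial>lborel) = (\<integral>\<^sup>+t\<in>{0<..}. (rearrangement f t - ennreal l) \<partial>lborel)"
proof (rule nn_integral_rearrangement)
  fix \<alpha> :: real assume "0 < \<alpha>"
  have "ennreal \<alpha> < r - ennreal l \<longleftrightarrow> ennreal (l + \<alpha>) < r" for r
  proof (cases r)
    case (real s)
    then show ?thesis using \<open>0 \<le> l\<close> \<open>0 < \<alpha>\<close> by (auto simp: ennreal_minus ennreal_less_iff simp del: ennreal_plus)
  qed auto
  then show "(\<exists>\<beta>\<ge>0. \<forall>r. ennreal \<alpha> < r - ennreal l \<longleftrightarrow> ennreal \<beta> < r) \<or> (\<forall>r. r - ennreal l \<le> ennreal \<alpha>)"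
    using \<open>0 \<le> l\<close> \<open>0 < \<alpha>\<close> by (intro disjI1 exI[of _ "l + \<alpha>"]) auto
qed measurable

lemma ennreal_less_power2_iff:
  assumes "0 < \<alpha>"
  shows "ennreal \<alpha> < r\<^sup>2 \<longleftrightarrow> ennreal (sqrt \<alpha>) < r"
proof (cases r)
  case (real s)
  have "\<alpha> < s\<^sup>2 \<longleftrightarrow> sqrt \<alpha> < s"
    using assms real by (metis less_le real_less_rsqrt real_sqrt_less_iff real_sqrt_unique)
  then show ?thesis using real assms by (simp add: ennreal_power ennreal_less_iff)
qed (use assms in auto)

lemma nn_integral_rearrangement_power2:
  assumes [measurable]: "f \<in> borel_measurable borel"
  shows "(\<integral>\<^sup>+x. (ennreal (norm (f x)))\<^sup>2 \<partial>lborel) = (\<integral>\<^sup>+t\<in>{0<..}. (rearrangement f t)\<^sup>2 \<partial>lborel)"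
proof (rule nn_integral_rearrangement)
  fix \<alpha> :: real assume "0 < \<alpha>"
  then show "(\<exists>\<beta>\<ge>0. \<forall>r. ennreal \<alpha> < r\<^sup>2 \<longleftrightarrow> ennreal \<beta> < r) \<or> (\<forall>r. r\<^sup>2 \<le> ennreal \<alpha>)"
    by (intro disjI1 exI[of _ "sqrt \<alpha>"]) (auto simp: ennreal_less_power2_iff)
qed measurable

lemma nn_integral_rearrangement_min_power2:
  assumes [measurable]: "f \<in> borel_measurable borel" and "0 \<le> l"
  shows "(\<integral>\<^sup>+x. (min (ennreal (norm (f x))) (ennreal l))\<^sup>2 \<partial>lborel)
    = (\<integral>\<^sup>+t\<in>{0<..}. (min (rearrangement f t) (ennreal l))\<^sup>2 \<partial>lborel)"
proof (rule nn_integral_rearrangement)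
  fix \<alpha> :: real assume "0 < \<alpha>"
  then show "(\<exists>\<beta>\<ge>0. \<forall>r. ennreal \<alpha> < (min r (ennreal l))\<^sup>2 \<longleftrightarrow> ennreal \<beta> < r) \<or> (\<forall>r. (min r (ennreal l))\<^sup>2 \<le> ennreal \<alpha>)"
    unfolding not_less[symmetric] ennreal_less_power2_iff[OF \<open>0 < \<alpha>\<close>]
    by (cases "ennreal (sqrt \<alpha>) < ennreal l") (auto intro: exI[of _ "sqrt \<alpha>"])
qed measurable

text \<open>For general sums the argument of the rearrangement has to be dilated. Here one summand
  is bounded by the constant \<open>A\<close>, which merely shifts the level.\<close>

lemma rearrangement_le_add:
  assumes [measurable]: "h \<in> borel_measurable borel" and A: "0 \<le> A"
    and le: "\<And>x. norm (g x) \<le> A + norm (h x)"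
  shows "rearrangement g t \<le> ennreal A + rearrangement h t"
proof -
  have "rearrangement g t - ennreal A \<le> rearrangement h t"
    unfolding rearrangement_def[of h]
  proof (rule INF_greatest)
    fix \<alpha> assume \<alpha>: "\<alpha> \<in> {\<alpha>::real. \<alpha> > 0 \<and> distribution_fun h \<alpha> \<le> ennreal t}"
    have "distribution_fun g (A + \<alpha>) \<le> distribution_fun h \<alpha>"
    proof (rule distribution_fun_mono)
      fix x assume "A + \<alpha> < norm (g x)" then show "\<alpha> < norm (h x)" using le[of x] by linarith
    qed measurable
    then have "rearrangement g t \<le> ennreal (A + \<alpha>)"
      using \<alpha> A by (intro rearrangement_le) auto
    then show "rearrangement g t - ennreal A \<le> ennreal \<alpha>" using A \<alpha>
      by (simp add: ennreal_minus_le_iff)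
  qed
  then show ?thesis by (simp add: ennreal_minus_le_iff)
qed

subsection \<open>Square means of the rearranged Fourier transform\<close>

text \<open>The map s -> 1/s reverses orientation, so the substitution is y = -1/s followed by a
  reflection. It is carried out on bounded intervals, whose upper end is then sent to
  infinity.\<close>

lemma nn_integral_inverse_substitution_le:
  fixes \<phi> :: "real \<Rightarrow> real"
  assumes [measurable]: "\<phi> \<in> borel_measurable borel" and nn: "\<And>t. 0 \<le> \<phi> t" and z: "0 < z"
  shows "(\<integral>\<^sup>+s\<in>{1/z<..}. ennreal (\<phi> (1 / s) / s\<^sup>2) \<partial>lborel) \<le> (\<integral>\<^sup>+t\<in>{0<..<z}. ennreal (\<phi> t) \<partial>lborel)"
proof -
  have "(\<integral>\<^sup>+s\<in>{1/z<..real n}. ennreal (\<phi> (1 / s) / s\<^sup>2) \<partial>lborel) \<le> (\<integral>\<^sup>+t\<in>{0<..<z}. ennreal (\<phi> t) \<partial>lborel)" for n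
  proof (cases "1 / z \<le> real n")
    case True
    have pos: "0 < 1 / z" using z by simp
    let ?b = "real n"
    let ?f = "\<lambda>y. \<phi> (- y)" and ?g = "\<lambda>s::real. - (1 / s)" and ?g' = "\<lambda>s::real. 1 / s\<^sup>2"
    have "(\<integral>\<^sup>+s\<in>{1/z<..?b}. ennreal (\<phi> (1 / s) / s\<^sup>2) \<partial>lborel)
      \<le> (\<integral>\<^sup>+s. ?f (?g s) * ?g' s * indicator {1/z..?b} s \<partial>lborel)"
      using nn by (intro nn_integral_mono) (auto simp: indicator_def)
    also have "\<dots> = (\<integral>\<^sup>+y. ?f y * indicator {?g (1/z)..?g ?b} y \<partial>lborel)"
    proof (rule nn_integral_substitution[symmetric, OF _ _ _ _ True])
      show "set_borel_measurable borel {?g (1/z)..?g ?b} ?f"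
        unfolding set_borel_measurable_def by measurable
      show "(?g has_real_derivative ?g' x) (at x)" if "x \<in> {1/z..?b}" for x
        using that pos by (auto intro!: derivative_eq_intros simp: power2_eq_square)
      show "continuous_on {1/z..?b} ?g'"
        using pos by (auto intro!: continuous_intros)
    qed auto
    also have "\<dots> = (\<integral>\<^sup>+y. ?f (0 + (-1) * y) * indicator {?g (1/z)..?g ?b} (0 + (-1) * y) \<partial>lborel)"
      by (subst nn_integral_real_affine[of _ "-1" 0]) auto
    also have "\<dots> \<le> (\<integral>\<^sup>+t\<in>{0<..<z}. ennreal (\<phi> t) \<partial>lborel)"
    proof (rule nn_integral_mono_AE)
      have "0 < ?b" using True pos by linarith
      show "AE y in lborel. ennreal (?f (0 + (-1) * y) * indicator {?g (1/z)..?g ?b} (0 + (-1) * y))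
          \<le> ennreal (\<phi> y) * indicator {0<..<z} y"
        using AE_lborel_singleton[of z]
      proof eventually_elim
        case (elim y)
        have "0 < y" if "- (1 / ?b) \<ge> - y" 
          using that \<open>0 < ?b\<close> by (smt (verit) divide_pos_pos)
        then show ?case using elim nn[of y] z by (auto simp: indicator_def)
      qed
    qed
    finally show ?thesis .
  qed simp
  then show ?thesis
    by (subst nn_integral_greaterThan_SUP) (auto intro: SUP_least)
qed

lemma ennreal_power2_add_le: "(a + b)\<^sup>2 \<le> 2 * a\<^sup>2 + 2 * (b::ennreal)\<^sup>2"
proof (cases a; cases b)
  fix r s assume rs: "0 \<le> r" "a = ennreal r" "0 \<le> s" "b = ennreal s"
  have "(r + s)\<^sup>2 \<le> 2 * r\<^sup>2 + 2 * s\<^sup>2"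
    using sum_squares_bound[of r s] by (simp add: power2_sum)
  then have "ennreal ((r + s)\<^sup>2) \<le> ennreal (2 * r\<^sup>2 + 2 * s\<^sup>2)" by (rule ennreal_leI)
  then show ?thesis using rs
    by (simp add: ennreal_power[symmetric] ennreal_mult ennreal_plus[symmetric] del: ennreal_plus)
      (simp add: ennreal_power ennreal_mult)
qed (auto simp: power2_eq_square ennreal_mult_top ennreal_top_mult)

text \<open>The cut lowers the modulus to at most \<open>l\<close> and keeps the argument:
  \<open>f2\<close> has modulus min(|f|, l) and \<open>f1\<close> the excess (|f| - l)+. Then
  \<open>A\<close> is the L1 norm of \<open>f1\<close>, which bounds its transform, and
  \<open>h\<close> is the transform of \<open>f2\<close>, estimated by Plancherel.\<close>

lemma fourier_truncation_split:
  fixes f :: "'a::euclidean_space \<Rightarrow> complex"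
  assumes f: "integrable lborel f" and l: "0 \<le> l"
  obtains A and h :: "'a \<Rightarrow> complex" where "0 \<le> A" "ennreal A = (\<integral>\<^sup>+t\<in>{0<..}. (rearrangement f t - ennreal l) \<partial>lborel)"
    "h \<in> borel_measurable borel" "\<And>x. norm (fourier f x) \<le> A + norm (h x)"
    "(\<integral>\<^sup>+x. (ennreal (norm (h x)))\<^sup>2 \<partial>lborel) \<le> (\<integral>\<^sup>+t\<in>{0<..}. (min (rearrangement f t) (ennreal l))\<^sup>2 \<partial>lborel)"
proof -
  have fm [measurable]: "f \<in> borel_measurable borel" using f by auto
  define f2 where "f2 x = (if norm (f x) \<le> l then f x else complex_of_real (l / norm (f x)) * f x)" for x
  define f1 where "f1 x = f x - f2 x" for x
  have [measurable]: "f2 \<in> borel_measurable borel" unfolding f2_def by measurable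
  have [measurable]: "f1 \<in> borel_measurable borel" unfolding f1_def by measurable
  have n2: "norm (f2 x) = min (norm (f x)) l" for x
    using l unfolding f2_def by (auto simp: norm_mult norm_divide min_def)
  have n1: "norm (f1 x) = max 0 (norm (f x) - l)" for x
  proof (cases "norm (f x) \<le> l")
    case False
    then have "f1 x = complex_of_real (1 - l / norm (f x)) * f x"
      unfolding f1_def f2_def by (simp add: algebra_simps)
    then have "norm (f1 x) = \<bar>1 - l / norm (f x)\<bar> * norm (f x)" by (simp only: norm_mult norm_of_real)
    also have "\<bar>1 - l / norm (f x)\<bar> = 1 - l / norm (f x)"
      using False l by (auto simp: divide_le_eq)
    also have "(1 - l / norm (f x)) * norm (f x) = norm (f x) - l"
      using False l by (auto simp: field_simps)
    finally show ?thesis using False by simp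
  qed (auto simp: f1_def f2_def)
  have i2: "integrable lborel f2"
    by (rule Bochner_Integration.integrable_bound[OF f]) (auto simp: n2)
  have i1: "integrable lborel f1"
    by (rule Bochner_Integration.integrable_bound[OF f]) (use l in \<open>auto simp: n1\<close>)
  define A where "A = (LINT x|lborel. norm (f1 x))"
  have split: "fourier f x = fourier f1 x + fourier f2 x" for x
    unfolding fourier_eq_lborel[OF fm] fourier_eq_lborel[OF \<open>f1 \<in> _\<close>] fourier_eq_lborel[OF \<open>f2 \<in> _\<close>]
      Bochner_Integration.integral_add[OF integrable_fourier_kernel_mult[OF i1] integrable_fourier_kernel_mult[OF i2], symmetric]
    by (simp add: f1_def ring_distribs[symmetric])
  have "norm (fourier f1 x) \<le> A" for x
    unfolding fourier_eq_lborel[OF \<open>f1 \<in> _\<close>] A_def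
    using integral_norm_bound[of lborel "\<lambda>y. fourier_kernel x y * f1 y"] by (simp add: norm_mult)
  then have "norm (fourier f x) \<le> A + norm (fourier f2 x)" for x
    unfolding split by (intro norm_triangle_le add_right_mono)
  moreover have "ennreal A = (\<integral>\<^sup>+t\<in>{0<..}. (rearrangement f t - ennreal l) \<partial>lborel)"
  proof -
    have "ennreal A = (\<integral>\<^sup>+x. ennreal (norm (f1 x)) \<partial>lborel)"
      unfolding A_def using i1 by (intro nn_integral_eq_integral[symmetric]) auto
    also have "\<dots> = (\<integral>\<^sup>+x. (ennreal (norm (f x)) - ennreal l) \<partial>lborel)"
      using l by (intro nn_integral_cong) (auto simp: n1 ennreal_minus max_def ennreal_neg)
    finally show ?thesis by (simp only: nn_integral_rearrangement_diff[OF fm l])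
  qed
  moreover have "(\<integral>\<^sup>+x. (ennreal (norm (fourier f2 x)))\<^sup>2 \<partial>lborel)
      \<le> (\<integral>\<^sup>+t\<in>{0<..}. (min (rearrangement f t) (ennreal l))\<^sup>2 \<partial>lborel)"
  proof -
    have "(\<integral>\<^sup>+x. (ennreal (norm (fourier f2 x)))\<^sup>2 \<partial>lborel) \<le> (\<integral>\<^sup>+x. (ennreal (norm (f2 x)))\<^sup>2 \<partial>lborel)"
      using fourier_Plancherel_le[OF i2] by (simp add: ennreal_power)
    also have "\<dots> = (\<integral>\<^sup>+x. (min (ennreal (norm (f x))) (ennreal l))\<^sup>2 \<partial>lborel)"
      using l by (intro nn_integral_cong) (auto simp: n2 min_def)
    finally show ?thesis by (simp only: nn_integral_rearrangement_min_power2[OF fm l])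
  qed
  moreover have "0 \<le> A" unfolding A_def by simp
  ultimately show ?thesis
    using that[of A "fourier f2"] borel_measurable_fourier[OF \<open>f2 \<in> _\<close>] by blast
qed

text \<open>At height \<open>?R (1 / z)\<close> the excess of the rearrangement is confined to (0,
  1/z), so \<open>A\<close> is at most \<open>H (1 / z)\<close>. Every term that arises is then
  compared with the one quantity \<open>G\<close>.\<close>

theorem rearrangement_fourier_power2_le:
  fixes f :: "'a::euclidean_space \<Rightarrow> complex"
  assumes f: "integrable lborel f" and z: "0 < z"
  shows "(\<integral>\<^sup>+t\<in>{0<..<z}. (rearrangement (fourier f) t)\<^sup>2 \<partial>lborel)
    \<le> 6 * (\<integral>\<^sup>+t\<in>{0<..<z}. (\<integral>\<^sup>+s\<in>{0<..<1/t}. rearrangement f s \<partial>lborel)\<^sup>2 \<partial>lborel)"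
proof -
  have fm [measurable]: "f \<in> borel_measurable borel" using f by auto
  let ?R = "rearrangement f"
  define H where "H x = (\<integral>\<^sup>+s\<in>{0<..<x}. ?R s \<partial>lborel)" for x
  define G where "G = (\<integral>\<^sup>+t\<in>{0<..<z}. (H (1 / t))\<^sup>2 \<partial>lborel)"
  have Hmono: "H x \<le> H y" if "x \<le> y" for x y
    unfolding H_def using that by (intro nn_integral_mono) (auto simp: indicator_def)
  have Hfin: "H x < top" for x
  proof -
    have "H x \<le> (\<integral>\<^sup>+t\<in>{0<..}. (?R t - ennreal 0) \<partial>lborel)"
      unfolding H_def by (intro nn_integral_mono) (auto simp: indicator_def)
    also have "\<dots> = (\<integral>\<^sup>+x. (ennreal (norm (f x)) - ennreal 0) \<partial>lborel)"
      by (rule nn_integral_rearrangement_diff[OF fm, symmetric]) simp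
    also have "\<dots> < top" using f by (auto simp: integrable_iff_bounded)
    finally show ?thesis .
  qed
  \<comment> \<open>A decreasing function is bounded by its mean over (0, x). Since \<open>H\<close>
    is finite, this also gives finiteness of \<open>?R\<close> on the positive axis.\<close>
  have RH: "ennreal x * ?R x \<le> H x" if "0 < x" for x
  proof -
    have "ennreal x * ?R x = (\<integral>\<^sup>+s\<in>{0<..<x}. ?R x \<partial>lborel)"
      using that by (subst nn_integral_cmult_indicator) (auto simp: mult.commute)
    also have "\<dots> \<le> H x" unfolding H_def
      by (intro nn_integral_mono) (auto simp: indicator_def intro: antimonoD[OF antimono_rearrangement])
    finally show ?thesis .
  qed
  have Rfin: "?R x < top" if "0 < x" for x
    using RH[OF that] Hfin[of x] that by (auto simp: less_top[symmetric] ennreal_mult_eq_top_iff top_unique)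
  define l where "l = enn2real (?R (1 / z))"
  have l: "0 \<le> l" "ennreal l = ?R (1 / z)"
    using Rfin[of "1 / z"] z unfolding l_def by auto
  define h where "h = H (1 / z)"
  obtain A and g :: "'a \<Rightarrow> complex" where A: "0 \<le> A" "ennreal A = (\<integral>\<^sup>+t\<in>{0<..}. (?R t - ennreal l) \<partial>lborel)"
    and gm [measurable]: "g \<in> borel_measurable borel" and le: "\<And>x. norm (fourier f x) \<le> A + norm (g x)"
    and g2: "(\<integral>\<^sup>+x. (ennreal (norm (g x)))\<^sup>2 \<partial>lborel) \<le> (\<integral>\<^sup>+t\<in>{0<..}. (min (?R t) (ennreal l))\<^sup>2 \<partial>lborel)"
    using fourier_truncation_split[OF f l(1)] by blast
  have Ah: "ennreal A \<le> h" unfolding A(2) h_def H_def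
  proof (rule nn_integral_mono)
    fix t :: real
    show "(?R t - ennreal l) * indicator {0<..} t \<le> ?R t * indicator {0<..<1/z} t"
    proof (cases "t < 1 / z")
      case False
      then have "?R t \<le> ennreal l" unfolding l(2) by (intro antimonoD[OF antimono_rearrangement]) simp
      then have "?R t - ennreal l = 0"
        by (subst diff_eq_0_iff_ennreal) (auto intro: le_less_trans)
      then show ?thesis by simp
    qed (auto simp: indicator_def)
  qed
  \<comment> \<open>For t < z one has 1/t > 1/z, so the integrand of \<open>G\<close> is at least
    the constant h^2 on (0, z).\<close>
  have hG: "ennreal z * h\<^sup>2 \<le> G"
  proof -
    have "ennreal z * h\<^sup>2 = (\<integral>\<^sup>+t\<in>{0<..<z}. h\<^sup>2 \<partial>lborel)"
      using z by (subst nn_integral_cmult_indicator) (auto simp: mult.commute)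
    also have "\<dots> \<le> G" unfolding G_def h_def
      by (intro nn_integral_mono) (auto simp: indicator_def intro!: power_mono Hmono frac_le)
    finally show ?thesis .
  qed
  \<comment> \<open>By \<open>RH\<close>, ?R s \<le> H s / s, and t = 1/s turns H(s)^2 / s^2 ds into
    the integrand of \<open>G\<close>. The form \<open>1 / (1 / s)\<close> below matches the
    substitution lemma.\<close>
  have tail: "(\<integral>\<^sup>+s\<in>{1/z<..}. (?R s)\<^sup>2 \<partial>lborel) \<le> G"
  proof -
    define Hr where "Hr x = enn2real (H x)" for x
    have Hr: "ennreal (Hr x) = H x" for x unfolding Hr_def using Hfin[of x] by simp
    have "mono Hr" unfolding Hr_def using Hmono Hfin by (intro monoI enn2real_mono) auto
    then have [measurable]: "Hr \<in> borel_measurable borel" by (rule borel_measurable_mono)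
    have "(\<integral>\<^sup>+s\<in>{1/z<..}. (?R s)\<^sup>2 \<partial>lborel) \<le> (\<integral>\<^sup>+s\<in>{1/z<..}. ennreal ((Hr (1 / (1 / s)))\<^sup>2 / s\<^sup>2) \<partial>lborel)"
    proof (rule nn_integral_mono)
      fix s :: real
      have "(?R s)\<^sup>2 \<le> ennreal ((Hr s)\<^sup>2 / s\<^sup>2)" if s: "0 < s"
      proof -
        obtain r where r: "0 \<le> r" "?R s = ennreal r" using Rfin[OF s] by (cases "?R s") auto
        have "ennreal (s * r) \<le> ennreal (Hr s)"
          using RH[OF that] that r unfolding Hr by (simp add: ennreal_mult)
        then have "s * r \<le> Hr s" by (subst (asm) ennreal_le_iff) (auto simp: Hr_def)
        then have "r \<le> Hr s / s" using that by (simp add: field_simps)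
        then have "r\<^sup>2 \<le> (Hr s / s)\<^sup>2" using r by (intro power_mono) auto
        then show ?thesis using r by (simp add: ennreal_power power_divide ennreal_leI)
      qed
      moreover have "0 < s" if "1 / z < s" using that z by (smt (verit) divide_pos_pos)
      ultimately show "(?R s)\<^sup>2 * indicator {1/z<..} s \<le> ennreal ((Hr (1 / (1 / s)))\<^sup>2 / s\<^sup>2) * indicator {1/z<..} s"
        by (auto simp: indicator_def)
    qed
    also have "\<dots> \<le> (\<integral>\<^sup>+t\<in>{0<..<z}. ennreal ((Hr (1 / t))\<^sup>2) \<partial>lborel)"
      by (rule nn_integral_inverse_substitution_le[where \<phi>="\<lambda>t. (Hr (1 / t))\<^sup>2"]) (use z in auto)
    also have "\<dots> = G"
      unfolding G_def Hr[symmetric] by (simp add: ennreal_power Hr_def)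
    finally show ?thesis .
  qed
  \<comment> \<open>The minimum is at most \<open>l\<close> up to 1/z and at most \<open>?R\<close>
    beyond. The flat part contributes l^2 / z = z (?R(1/z) / z)^2 \<le> z h^2, so each of the two
    parts costs one \<open>G\<close>.\<close>
  have "(\<integral>\<^sup>+t\<in>{0<..}. (min (?R t) (ennreal l))\<^sup>2 \<partial>lborel)
      \<le> (\<integral>\<^sup>+t. ((ennreal l)\<^sup>2 * indicator {0<..1/z} t + (?R t)\<^sup>2 * indicator {1/z<..} t) \<partial>lborel)"
    by (intro nn_integral_mono) (auto simp: indicator_def intro!: power_mono)
  also have "\<dots> = (ennreal l)\<^sup>2 * ennreal (1 / z) + (\<integral>\<^sup>+s\<in>{1/z<..}. (?R s)\<^sup>2 \<partial>lborel)"
    using z by (subst nn_integral_add) (auto simp: nn_integral_cmult_indicator)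
  also have "(ennreal l)\<^sup>2 * ennreal (1 / z) = ennreal z * (ennreal (1 / z) * ?R (1 / z))\<^sup>2"
    unfolding l(2)[symmetric] using z l(1)
    by (simp add: ennreal_mult[symmetric] ennreal_power power2_eq_square)
  also have "\<dots> \<le> ennreal z * h\<^sup>2"
    unfolding h_def using z by (intro mult_left_mono power_mono RH) auto
  also have "ennreal z * h\<^sup>2 + (\<integral>\<^sup>+s\<in>{1/z<..}. (?R s)\<^sup>2 \<partial>lborel) \<le> G + G"
    by (intro add_mono hG tail)
  finally have trunc: "(\<integral>\<^sup>+t\<in>{0<..}. (min (?R t) (ennreal l))\<^sup>2 \<partial>lborel) \<le> G + G"
    by (simp add: add_right_mono)
  have "(\<integral>\<^sup>+t\<in>{0<..<z}. (rearrangement (fourier f) t)\<^sup>2 \<partial>lborel)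
      \<le> (\<integral>\<^sup>+t. (2 * (ennreal A)\<^sup>2 * indicator {0<..<z} t + 2 * ((rearrangement g t)\<^sup>2 * indicator {0<..} t)) \<partial>lborel)"
  proof (rule nn_integral_mono)
    fix t :: real
    have "(rearrangement (fourier f) t)\<^sup>2 \<le> (ennreal A + rearrangement g t)\<^sup>2"
      by (intro power_mono rearrangement_le_add[OF gm A(1) le]) simp
    also have "\<dots> \<le> 2 * (ennreal A)\<^sup>2 + 2 * (rearrangement g t)\<^sup>2" by (rule ennreal_power2_add_le)
    finally show "(rearrangement (fourier f) t)\<^sup>2 * indicator {0<..<z} t
      \<le> 2 * (ennreal A)\<^sup>2 * indicator {0<..<z} t + 2 * ((rearrangement g t)\<^sup>2 * indicator {0<..} t)"
      by (auto simp: indicator_def)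
  qed
  also have "\<dots> = 2 * (ennreal z * (ennreal A)\<^sup>2) + 2 * (\<integral>\<^sup>+t\<in>{0<..}. (rearrangement g t)\<^sup>2 \<partial>lborel)"
    using z by (subst nn_integral_add, measurable)
      (simp add: nn_integral_cmult_indicator nn_integral_cmult, simp add: mult_ac)
  \<comment> \<open>Origin of the constant 6: squaring the sum doubles both parts; the bounded part
    costs one \<open>G\<close>, the Plancherel part two.\<close>
  also have "\<dots> \<le> 2 * G + 2 * (G + G)"
  proof (intro add_mono mult_left_mono)
    show "ennreal z * (ennreal A)\<^sup>2 \<le> G"
      using Ah by (intro order_trans[OF _ hG] mult_left_mono power_mono) auto
    show "(\<integral>\<^sup>+t\<in>{0<..}. (rearrangement g t)\<^sup>2 \<partial>lborel) \<le> G + G"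
      unfolding nn_integral_rearrangement_power2[OF gm, symmetric]
      using g2 trunc by (rule order_trans)
  qed auto
  also have "\<dots> = 6 * G"
  proof -
    have "2 * G + 2 * (G + G) = (2 + (2 + 2)) * G" by (simp only: ring_distribs)
    then show ?thesis by simp
  qed
  finally show ?thesis unfolding G_def H_def .
qed

subsection \<open>Powers on the extended half-line\<close>

lemma ennreal_epowr: "0 \<le> r \<Longrightarrow> 0 < a \<Longrightarrow> ennreal r epowr a = ennreal (r powr a)"
  by (simp add: epowr_def)

lemma top_epowr [simp]: "0 < a \<Longrightarrow> top epowr a = top"
  by (simp add: epowr_def)

lemma zero_epowr [simp]: "0 < a \<Longrightarrow> 0 epowr a = 0"
  by (simp add: epowr_def)

lemma epowr_zero [simp]: "x epowr 0 = 1"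
  by (simp add: epowr_def)

lemma epowr_eq_0_iff: "0 < a \<Longrightarrow> x epowr a = 0 \<longleftrightarrow> x = 0"
  by (cases x) (auto simp: ennreal_epowr ennreal_eq_0_iff)

lemma epowr_eq_top_iff: "0 < a \<Longrightarrow> x epowr a = top \<longleftrightarrow> x = top"
  by (cases x) (auto simp: ennreal_epowr)

lemma epowr_mono: "0 \<le> a \<Longrightarrow> x \<le> y \<Longrightarrow> x epowr a \<le> y epowr a"
  by (cases "a = 0"; cases x; cases y) (auto simp: ennreal_epowr top_unique intro!: ennreal_leI powr_mono2)

text \<open>Positivity of the exponent matters: for a < 0, x = 0 and y = \<infinity> the left side
  is \<infinity> and the right side is 0.\<close>

lemma epowr_mult: "0 < a \<Longrightarrow> (x * y) epowr a = x epowr a * y epowr a"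
  by (cases x; cases y; cases "x = 0"; cases "y = 0")
     (auto simp: ennreal_epowr ennreal_mult[symmetric] powr_mult ennreal_mult_top ennreal_top_mult epowr_eq_0_iff powr_eq_0_iff)

lemma epowr_epowr: "0 < a \<Longrightarrow> 0 < b \<Longrightarrow> (x epowr a) epowr b = x epowr (a * b)"
  by (cases x) (auto simp: ennreal_epowr powr_powr)

lemma epowr_add: "0 \<le> a \<Longrightarrow> 0 \<le> b \<Longrightarrow> x epowr (a + b) = x epowr a * x epowr b"
  by (cases x; cases "a = 0"; cases "b = 0") (auto simp: ennreal_epowr powr_add ennreal_mult)

lemma epowr_one [simp]: "x epowr 1 = x"
  by (cases x) (auto simp: ennreal_epowr)

lemma epowr_two: "x epowr 2 = x\<^sup>2"
  by (cases x) (auto simp: ennreal_epowr ennreal_power)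

lemma borel_measurable_epowr [measurable (raw)]:
  assumes [measurable]: "f \<in> borel_measurable M"
  shows "(\<lambda>x. f x epowr a) \<in> borel_measurable M"
  unfolding epowr_def by measurable

section \<open>From square means to q-th powers\<close>

text \<open>If 2 D y^2 \<le> x^2, the left side is at most half of x^q. Otherwise x \<le> sqrt(2 D)
  y, and bounding x^(q-2) accordingly produces the constant D (2 D)^((q-2)/2).\<close>

lemma young_absorb_epowr:
  fixes x y :: ennreal
  assumes q: "2 \<le> q" and D: "0 < D" and x: "x < top"
  shows "ennreal D * y\<^sup>2 * x epowr (q - 2)
    \<le> ennreal (1 / 2) * x epowr q + ennreal (D * (2 * D) powr ((q - 2) / 2)) * y epowr q"
proof (cases y)
  case top
  have "0 < D * (2 * D) powr ((q - 2) / 2)" using D by simp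
  then have "ennreal (D * (2 * D) powr ((q - 2) / 2)) * y epowr q = top"
    using top q D by (simp add: ennreal_mult_top)
  then show ?thesis by simp
next
  case (real s)
  obtain r where r: "0 \<le> r" "x = ennreal r" using x by (cases x) auto
  have "D * s\<^sup>2 * r powr (q - 2) \<le> 1 / 2 * r powr q + D * (2 * D) powr ((q - 2) / 2) * s powr q"
    if "r \<noteq> 0"
  proof (cases "2 * D * s\<^sup>2 \<le> r\<^sup>2")
    case True
    then have "D * s\<^sup>2 * r powr (q - 2) \<le> (1 / 2 * r powr 2) * r powr (q - 2)"
      using r that by (intro mult_right_mono) auto
    also have "\<dots> = 1 / 2 * r powr q" using powr_add[of r 2 "q - 2"] by simp
    finally show ?thesis using D by (intro add_increasing2) auto
  next
    case False
    have "r\<^sup>2 \<le> (sqrt (2 * D) * s)\<^sup>2"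
      using False D by (simp add: power_mult_distrib)
    then have "r \<le> sqrt (2 * D) * s"
      by (rule power2_le_imp_le) (use D real in auto)
    then have "r powr (q - 2) \<le> (sqrt (2 * D) * s) powr (q - 2)"
      using r q by (intro powr_mono2) auto
    also have "\<dots> = (2 * D) powr ((q - 2) / 2) * s powr (q - 2)"
      using D real by (simp add: powr_mult powr_half_sqrt[symmetric] powr_powr)
    finally have "D * s\<^sup>2 * r powr (q - 2) \<le> D * s powr 2 * ((2 * D) powr ((q - 2) / 2) * s powr (q - 2))"
      using D real by (intro mult_mono) auto
    also have "\<dots> = D * (2 * D) powr ((q - 2) / 2) * (s powr 2 * s powr (q - 2))" by simp
    also have "s powr 2 * s powr (q - 2) = s powr q" using powr_add[of s 2 "q - 2"] by simp
    finally show ?thesis by (intro add_increasing) auto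
  qed
  then have "ennreal (D * s\<^sup>2 * r powr (q - 2)) \<le> ennreal (1 / 2 * r powr q + D * (2 * D) powr ((q - 2) / 2) * s powr q)"
    if "r \<noteq> 0" using that by (intro ennreal_leI) auto
  note nz = this
  \<comment> \<open>The value r = 0 is separate because the exponent q - 2 may be 0:
    \<open>epowr\<close> then gives 1, whereas the real power \<open>0 powr 0\<close> is 0.\<close>
  show ?thesis
  proof (cases "r = 0")
    case True
    show ?thesis
    proof (cases "q = 2")
      case True
      then show ?thesis using r \<open>r = 0\<close> D by (simp add: epowr_two)
    next
      case False
      then show ?thesis using q r \<open>r = 0\<close> by simp
    qed
  next
    case False
    have "ennreal r epowr (q - 2) = ennreal (r powr (q - 2))"
      using r q False by (cases "q = 2") (auto simp: ennreal_epowr)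
    then show ?thesis
      using nz[OF False] r real D q ennreal_mult[of "1 / 2" "r powr q"]
      by (simp add: ennreal_epowr ennreal_power[symmetric] ennreal_mult)
  qed
qed

text \<open>Half of the left-hand side is absorbed, which requires it to be finite: hence the
  truncated weights \<open>kn\<close>.\<close>

lemma nn_integral_epowr_le_of_power2_le:
  fixes F g k :: "real \<Rightarrow> ennreal"
  assumes q: "2 \<le> q" and D: "0 < D"
    and F: "antimono F" "\<And>t. 0 < t \<Longrightarrow> F t \<le> ennreal B" and k: "antimono k"
    and [measurable]: "g \<in> borel_measurable borel"
    and le: "\<And>z. 0 < z \<Longrightarrow> (\<integral>\<^sup>+t\<in>{0<..<z}. (F t)\<^sup>2 \<partial>lborel) \<le> ennreal D * (\<integral>\<^sup>+t\<in>{0<..<z}. (g t)\<^sup>2 \<partial>lborel)"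
  shows "(\<integral>\<^sup>+t\<in>{0<..}. F t epowr q * k t \<partial>lborel)
    \<le> ennreal (2 * (D * (2 * D) powr ((q - 2) / 2))) * (\<integral>\<^sup>+t\<in>{0<..}. g t epowr q * k t \<partial>lborel)"
proof -
  note [measurable] = borel_measurable_antimono_ennreal[OF F(1)] borel_measurable_antimono_ennreal[OF k]
  define C where "C = D * (2 * D) powr ((q - 2) / 2)"
  have C: "0 \<le> C" using D unfolding C_def by simp
  \<comment> \<open>Cutting \<open>k\<close> at height \<open>n\<close> and at the point
    \<open>n\<close> keeps it decreasing and bounds the truncated integral by B^q n^2.\<close>
  define kn where "kn n t = min (k t) (ennreal (real n)) * indicator {..real n} t" for n :: nat and t
  have [measurable]: "kn n \<in> borel_measurable borel" for n unfolding kn_def by measurable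
  have kn_le: "kn n t \<le> k t" for n t unfolding kn_def by (auto simp: indicator_def)
  have bound: "(\<integral>\<^sup>+t\<in>{0<..}. F t epowr q * kn n t \<partial>lborel)
      \<le> ennreal (2 * C) * (\<integral>\<^sup>+t\<in>{0<..}. g t epowr q * k t \<partial>lborel)" for n
  proof -
    define X where "X = (\<integral>\<^sup>+t\<in>{0<..}. F t epowr q * kn n t \<partial>lborel)"
    define Y where "Y = (\<integral>\<^sup>+t\<in>{0<..}. g t epowr q * k t \<partial>lborel)"
    have "X \<le> (\<integral>\<^sup>+t. ennreal B epowr q * ennreal (real n) * indicator {0<..real n} t \<partial>lborel)"
      unfolding X_def
    proof (rule nn_integral_mono)
      fix t :: real
      show "F t epowr q * kn n t * indicator {0<..} t \<le> ennreal B epowr q * ennreal (real n) * indicator {0<..real n} t"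
        using F(2)[of t] q unfolding kn_def by (auto simp: indicator_def intro!: mult_mono epowr_mono)
    qed
    also have "\<dots> = ennreal B epowr q * ennreal (real n) * ennreal (real n)"
      by (subst nn_integral_cmult_indicator) auto
    also have "\<dots> < top"
      using q epowr_eq_top_iff[of q "ennreal B"] by (auto simp: less_top[symmetric] ennreal_mult_eq_top_iff)
    finally have fin: "X < top" .
    have "X = (\<integral>\<^sup>+t\<in>{0<..}. (F t epowr (q - 2) * kn n t) * (F t)\<^sup>2 \<partial>lborel)"
      unfolding X_def
    proof (intro nn_integral_cong)
      fix t :: real
      have "F t epowr q = F t epowr (q - 2) * (F t)\<^sup>2"
        using epowr_add[of "q - 2" 2 "F t"] q by (simp add: epowr_two)
      then show "F t epowr q * kn n t * indicator {0<..} t = F t epowr (q - 2) * kn n t * (F t)\<^sup>2 * indicator {0<..} t"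
        by (simp add: mult_ac)
    qed
    \<comment> \<open>Hardy's lemma with the decreasing factor F^(q-2) kn, applied to the comparison
      of F^2 with D g^2.\<close>
    also have "\<dots> \<le> (\<integral>\<^sup>+t\<in>{0<..}. (F t epowr (q - 2) * kn n t) * (ennreal D * (g t)\<^sup>2) \<partial>lborel)"
    proof (rule nn_integral_antimono_mult_le)
      show "antimono (\<lambda>t. F t epowr (q - 2) * kn n t)"
      proof (rule antimonoI)
        fix s t :: real assume st: "s \<le> t"
        have "kn n t \<le> kn n s" unfolding kn_def using antimonoD[OF k st] st
          by (intro mult_mono min.mono) (auto simp: indicator_def)
        then show "F t epowr (q - 2) * kn n t \<le> F s epowr (q - 2) * kn n s"
          using q antimonoD[OF F(1) st] by (intro mult_mono epowr_mono) auto
      qed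
      show "(\<integral>\<^sup>+t\<in>{0<..<x}. (F t)\<^sup>2 \<partial>lborel) \<le> (\<integral>\<^sup>+t\<in>{0<..<x}. ennreal D * (g t)\<^sup>2 \<partial>lborel)" if "0 < x" for x
        using le[OF that] by (simp add: nn_integral_cmult mult.assoc)
    qed measurable
    also have "\<dots> \<le> (\<integral>\<^sup>+t. (ennreal (1 / 2) * (F t epowr q * kn n t * indicator {0<..} t)
        + ennreal C * (g t epowr q * k t * indicator {0<..} t)) \<partial>lborel)"
    proof (rule nn_integral_mono)
      fix t :: real
      show "F t epowr (q - 2) * kn n t * (ennreal D * (g t)\<^sup>2) * indicator {0<..} t
        \<le> ennreal (1 / 2) * (F t epowr q * kn n t * indicator {0<..} t)
        + ennreal C * (g t epowr q * k t * indicator {0<..} t)"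
      proof (cases "0 < t")
        case True
        have "F t < top" using F(2)[OF True] by (auto intro: le_less_trans)
        then have "ennreal D * (g t)\<^sup>2 * F t epowr (q - 2) \<le> ennreal (1 / 2) * F t epowr q + ennreal C * g t epowr q"
          unfolding C_def by (rule young_absorb_epowr[OF q D])
        then have "ennreal D * (g t)\<^sup>2 * F t epowr (q - 2) * kn n t
            \<le> (ennreal (1 / 2) * F t epowr q + ennreal C * g t epowr q) * kn n t"
          by (rule mult_right_mono) simp
        also have "\<dots> = ennreal (1 / 2) * F t epowr q * kn n t + ennreal C * g t epowr q * kn n t"
          by (rule distrib_right)
        also have "\<dots> \<le> ennreal (1 / 2) * F t epowr q * kn n t + ennreal C * g t epowr q * k t"
          by (intro add_left_mono mult_left_mono kn_le) simp
        finally show ?thesis using True by (simp add: mult_ac)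
      qed simp
    qed
    also have "\<dots> = ennreal (1 / 2) * X + ennreal C * Y"
      unfolding X_def Y_def by (subst nn_integral_add, measurable) (simp add: nn_integral_cmult)
    finally have XY: "X \<le> ennreal (1 / 2) * X + ennreal C * Y" .
    have "X \<le> ennreal (2 * C) * Y"
    proof (cases Y)
      case top
      then show ?thesis using XY fin
        by (cases "C = 0") (use D in \<open>auto simp: C_def ennreal_mult_top\<close>)
    next
      case (real y)
      obtain x where x: "0 \<le> x" "X = ennreal x" using fin by (cases X) auto
      have "ennreal (1 / 2 * x + C * y) = ennreal (1 / 2 * x) + ennreal (C * y)"
        by (rule ennreal_plus) (use x real C in auto)
      also have "ennreal (1 / 2 * x) = ennreal (1 / 2) * ennreal x"
        by (rule ennreal_mult) (use x in auto)
      also have "ennreal (C * y) = ennreal C * ennreal y"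
        by (rule ennreal_mult) (use real C in auto)
      finally have "ennreal x \<le> ennreal (1 / 2 * x + C * y)"
        using XY unfolding x(2) real(2) by simp
      then have "x \<le> 1 / 2 * x + C * y"
        using x real C by (subst (asm) ennreal_le_iff) auto
      then have "x \<le> 2 * C * y" by simp
      then show ?thesis using x real C by (simp add: ennreal_mult[symmetric] ennreal_leI)
    qed
    then show ?thesis unfolding X_def Y_def .
  qed
  have "(\<integral>\<^sup>+t\<in>{0<..}. F t epowr q * k t \<partial>lborel) = (\<integral>\<^sup>+t. (SUP n. F t epowr q * kn n t * indicator {0<..} t) \<partial>lborel)"
  proof (intro nn_integral_cong)
    fix t :: real
    have lim: "(SUP n. kn n t) = k t"
    proof (rule antisym)
      show "(SUP n. kn n t) \<le> k t" by (intro SUP_least kn_le)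
      show "k t \<le> (SUP n. kn n t)"
      proof (rule ccontr)
        assume "\<not> ?thesis"
        then have less: "(SUP n. kn n t) < k t" by simp
        then have "(SUP n. kn n t) < top" using less_le_trans[OF less top_greatest] by simp
        then obtain m :: nat where m: "(SUP n. kn n t) < ennreal (real m)"
          using ennreal_Ex_less_of_nat unfolding ennreal_of_nat_eq_real_of_nat by blast
        obtain j where j: "t \<le> real j" using real_arch_simple by blast
        define n where "n = max m j"
        have "min (k t) (ennreal (real n)) = kn n t" unfolding kn_def n_def using j by (auto simp: indicator_def)
        also have "\<dots> \<le> (SUP n. kn n t)" by (rule SUP_upper) simp
        finally have "ennreal (real n) \<le> (SUP n. kn n t)" using less by (auto simp: min_def split: if_splits)
        moreover have "ennreal (real m) \<le> ennreal (real n)" unfolding n_def by (intro ennreal_leI) simp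
        ultimately show False using m by (meson leD order_trans)
      qed
    qed
    have "(SUP n. F t epowr q * kn n t * indicator {0<..} t) = (SUP n. (F t epowr q * indicator {0<..} t) * kn n t)"
      by (simp add: mult_ac)
    also have "\<dots> = F t epowr q * indicator {0<..} t * k t"
      unfolding lim[symmetric] by (rule SUP_mult_left_ennreal[symmetric])
    finally show "F t epowr q * k t * indicator {0<..} t = (SUP n. F t epowr q * kn n t * indicator {0<..} t)"
      by (simp add: mult_ac)
  qed
  also have "\<dots> = (SUP n. \<integral>\<^sup>+t\<in>{0<..}. F t epowr q * kn n t \<partial>lborel)"
  proof (rule nn_integral_monotone_convergence_SUP)
    have "kn m t \<le> kn n t" if "m \<le> n" for m n t
      unfolding kn_def using that by (intro mult_mono min.mono) (auto simp: indicator_def intro!: ennreal_leI)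
    then show "incseq (\<lambda>n t. F t epowr q * kn n t * indicator {0<..} t)"
      by (auto simp: incseq_def le_fun_def intro!: mult_right_mono mult_left_mono)
  qed measurable
  also have "\<dots> \<le> ennreal (2 * C) * (\<integral>\<^sup>+t\<in>{0<..}. g t epowr q * k t \<partial>lborel)"
    by (intro SUP_least bound)
  finally show ?thesis unfolding C_def .
qed

subsection \<open>A decreasing substitute for the level function\<close>

text \<open>These are slopes of chords over [t, 2t]. Moving from [s, 2s] to [s, 2t] and then to
  [t, 2t] shifts one endpoint to the right at a time, and each shift lowers the slope of a concave
  function.\<close>

lemma concave_slope_antimono:
  fixes G :: "real \<Rightarrow> real"
  assumes G: "concave_on {0<..} G" and st: "0 < s" "s \<le> t"
  shows "(G (2 * t) - G t) / t \<le> (G (2 * s) - G s) / s"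
proof (cases "s = t")
  case False
  have f: "convex_on {0<..} (\<lambda>x. - G x)" using G by (simp add: concave_on_def)
  have "(- G s - - G (2 * s)) / (s - 2 * s) \<le> (- G s - - G (2 * t)) / (s - 2 * t)"
    by (rule convex_on_slope_le(1)[OF f]) (use st False in auto)
  also have "\<dots> \<le> (- G t - - G (2 * t)) / (t - 2 * t)"
    by (rule convex_on_slope_le(2)[OF f]) (use st False in auto)
  finally show ?thesis using st by (simp add: field_simps)
qed simp

text \<open>Write x = (2/3)(x/2) + (1/3)(2x) and drop the nonnegative term at x/2. The point x/2
  stands in for 0, which lies outside the domain of concavity.\<close>

lemma concave_nonneg_double_le:
  fixes G :: "real \<Rightarrow> real"
  assumes G: "concave_on {0<..} G" and nn: "\<And>x. 0 < x \<Longrightarrow> 0 \<le> G x" and x: "0 < x"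
  shows "G (2 * x) \<le> 3 * G x"
proof -
  have "(1 - 1 / 3) * G (x / 2) + 1 / 3 * G (2 * x) \<le> G ((1 - 1 / 3) *\<^sub>R (x / 2) + (1 / 3) *\<^sub>R (2 * x))"
    by (rule concave_onD[OF G]) (use x in auto)
  also have "(1 - 1 / 3) *\<^sub>R (x / 2) + (1 / 3) *\<^sub>R (2 * x) = x" by simp
  finally show ?thesis using nn[of "x / 2"] x by simp
qed

text \<open>By Tonelli the integral of \<open>k\<close> over (0, x) equals that of v \<omega>, where
  \<omega>(s) integrates 1/t over the t < x in (s/2, s]. There 1/t lies between 1/s and 2/s, so
  \<omega> \<ge> 1/2 on (0, x); moreover \<omega> \<le> 1 everywhere, and \<omega> vanishes outside
  (0, 2x).\<close>

lemma nn_integral_dyadic_average: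
  fixes v :: "real \<Rightarrow> ennreal"
  assumes [measurable]: "v \<in> borel_measurable borel" and x: "0 < x"
  defines "k \<equiv> \<lambda>t. ennreal (1 / t) * (\<integral>\<^sup>+s\<in>{t..<2*t}. v s \<partial>lborel)"
  shows "(\<integral>\<^sup>+s\<in>{0<..<x}. v s \<partial>lborel) \<le> 2 * (\<integral>\<^sup>+t\<in>{0<..<x}. k t \<partial>lborel)"
    and "(\<integral>\<^sup>+t\<in>{0<..<x}. k t \<partial>lborel) \<le> (\<integral>\<^sup>+s\<in>{0<..<2*x}. v s \<partial>lborel)"
proof -
  define \<omega> where "\<omega> s = (\<integral>\<^sup>+t. ennreal (1 / t) * indicator {t. 0 < t \<and> t < x \<and> t \<le> s \<and> s < 2 * t} t \<partial>lborel)" for s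
  have [measurable]: "\<omega> \<in> borel_measurable borel" unfolding \<omega>_def by measurable
  have "(\<integral>\<^sup>+t\<in>{0<..<x}. k t \<partial>lborel)
     = (\<integral>\<^sup>+t. \<integral>\<^sup>+s. v s * (ennreal (1 / t) * indicator {t. 0 < t \<and> t < x \<and> t \<le> s \<and> s < 2 * t} t) \<partial>lborel \<partial>lborel)"
    unfolding k_def
  proof (intro nn_integral_cong)
    fix t :: real
    have "ennreal (1 / t) * (\<integral>\<^sup>+s\<in>{t..<2*t}. v s \<partial>lborel) * indicator {0<..<x} t
      = (\<integral>\<^sup>+s. ennreal (1 / t) * (v s * indicator {t..<2*t} s) * indicator {0<..<x} t \<partial>lborel)"
      by (simp add: nn_integral_cmult nn_integral_multc)
    also have "\<dots> = (\<integral>\<^sup>+s. v s * (ennreal (1 / t) * indicator {t. 0 < t \<and> t < x \<and> t \<le> s \<and> s < 2 * t} t) \<partial>lborel)"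
      by (intro nn_integral_cong) (auto simp: indicator_def mult_ac)
    finally show "ennreal (1 / t) * (\<integral>\<^sup>+s\<in>{t..<2*t}. v s \<partial>lborel) * indicator {0<..<x} t = \<dots>" .
  qed
  also have "\<dots> = (\<integral>\<^sup>+s. \<integral>\<^sup>+t. v s * (ennreal (1 / t) * indicator {t. 0 < t \<and> t < x \<and> t \<le> s \<and> s < 2 * t} t) \<partial>lborel \<partial>lborel)"
    by (rule lborel_pair.Fubini') measurable
  also have "\<dots> = (\<integral>\<^sup>+s. v s * \<omega> s \<partial>lborel)"
    unfolding \<omega>_def by (simp add: nn_integral_cmult)
  finally have eq: "(\<integral>\<^sup>+t\<in>{0<..<x}. k t \<partial>lborel) = (\<integral>\<^sup>+s. v s * \<omega> s \<partial>lborel)" .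
  have lower: "1 \<le> 2 * \<omega> s" if s: "0 < s" "s < x" for s
  proof -
    have "ennreal (1 / s) * ennreal (s / 2) = (\<integral>\<^sup>+t. ennreal (1 / s) * indicator {s/2<..s} t \<partial>lborel)"
      using s by (subst nn_integral_cmult_indicator) auto
    also have "\<dots> \<le> \<omega> s" unfolding \<omega>_def
      using s by (intro nn_integral_mono) (auto simp: indicator_def intro!: ennreal_leI frac_le)
    finally have "2 * (ennreal (1 / s) * ennreal (s / 2)) \<le> 2 * \<omega> s" by (rule mult_left_mono) simp
    moreover have "2 * (ennreal (1 / s) * ennreal (s / 2)) = 1"
    proof -
      have "ennreal (2 * (1 / s * (s / 2))) = ennreal 2 * ennreal (1 / s * (s / 2))"
        by (rule ennreal_mult') simp
      also have "ennreal (1 / s * (s / 2)) = ennreal (1 / s) * ennreal (s / 2)"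
        by (rule ennreal_mult') (use s in simp)
      also have "2 * (1 / s * (s / 2)) = 1" using s by simp
      finally show ?thesis by simp
    qed
    ultimately show ?thesis by simp
  qed
  have upper: "\<omega> s \<le> indicator {0<..<2*x} s" for s
  proof (cases "0 < s \<and> s < 2 * x")
    case True
    have "\<omega> s \<le> (\<integral>\<^sup>+t. ennreal (2 / s) * indicator {s/2<..s} t \<partial>lborel)" unfolding \<omega>_def
      using True by (intro nn_integral_mono) (auto simp: indicator_def field_simps intro!: ennreal_leI)
    also have "\<dots> = ennreal (2 / s) * ennreal (s / 2)"
      using True by (subst nn_integral_cmult_indicator) auto
    also have "\<dots> = 1" using True by (simp add: ennreal_mult[symmetric])
    finally show ?thesis using True by simp
  next
    case False
    then have "\<omega> s = (\<integral>\<^sup>+t. 0 \<partial>(lborel :: real measure))" unfolding \<omega>_def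
      by (intro nn_integral_cong) (auto simp: indicator_def)
    then show ?thesis by simp
  qed
  show "(\<integral>\<^sup>+s\<in>{0<..<x}. v s \<partial>lborel) \<le> 2 * (\<integral>\<^sup>+t\<in>{0<..<x}. k t \<partial>lborel)"
  proof -
    have "(\<integral>\<^sup>+s\<in>{0<..<x}. v s \<partial>lborel) \<le> (\<integral>\<^sup>+s. 2 * (v s * \<omega> s) \<partial>lborel)"
    proof (rule nn_integral_mono)
      fix s
      show "v s * indicator {0<..<x} s \<le> 2 * (v s * \<omega> s)"
        using mult_left_mono[OF lower[of s], of "v s"] by (auto simp: indicator_def mult_ac)
    qed
    then show ?thesis unfolding eq by (simp add: nn_integral_cmult)
  qed
  show "(\<integral>\<^sup>+t\<in>{0<..<x}. k t \<partial>lborel) \<le> (\<integral>\<^sup>+s\<in>{0<..<2*x}. v s \<partial>lborel)"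
    unfolding eq by (intro nn_integral_mono mult_left_mono upper) simp
qed

text \<open>The weight is the dyadic average of \<open>v\<close>, that is, the chord slope of
  \<open>G\<close> over [t, 2t], which concavity makes decreasing. The factor 2 is the averaging
  loss; the factor 3 comes from G(2x) \<le> 3 G(x).\<close>

lemma concave_primitive_decreasing_weight:
  fixes v :: "real \<Rightarrow> ennreal" and G :: "real \<Rightarrow> real"
  assumes [measurable]: "v \<in> borel_measurable borel"
    and G: "concave_on {0<..} G" "\<And>x. 0 < x \<Longrightarrow> 0 \<le> G x"
    and eq: "\<And>x. 0 < x \<Longrightarrow> (\<integral>\<^sup>+s\<in>{0<..<x}. v s \<partial>lborel) = ennreal (G x)"
  obtains k where "antimono k"
    "\<And>x. 0 < x \<Longrightarrow> (\<integral>\<^sup>+s\<in>{0<..<x}. v s \<partial>lborel) \<le> 2 * (\<integral>\<^sup>+t\<in>{0<..<x}. k t \<partial>lborel)"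
    "\<And>x. 0 < x \<Longrightarrow> (\<integral>\<^sup>+t\<in>{0<..<x}. k t \<partial>lborel) \<le> 3 * (\<integral>\<^sup>+s\<in>{0<..<x}. v s \<partial>lborel)"
proof
  define k0 where "k0 t = ennreal (1 / t) * (\<integral>\<^sup>+s\<in>{t..<2*t}. v s \<partial>lborel)" for t
  \<comment> \<open>\<open>antimono\<close> ranges over all reals, but \<open>k0\<close> is 0 for t
    \<le> 0; the value \<open>top\<close> there restores monotonicity and affects no integral over
    positive t.\<close>
  define k where "k t = (if t \<le> 0 then top else k0 t)" for t
  have k_eq: "(\<integral>\<^sup>+t\<in>{0<..<x}. k t \<partial>lborel) = (\<integral>\<^sup>+t\<in>{0<..<x}. k0 t \<partial>lborel)" for x
    by (intro nn_integral_cong) (auto simp: k_def indicator_def)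
  have k0: "k0 t = ennreal ((G (2 * t) - G t) / t)" if t: "0 < t" for t
  proof -
    have "ennreal (G (2 * t)) = (\<integral>\<^sup>+s. (v s * indicator {0<..<t} s + v s * indicator {t..<2*t} s) \<partial>lborel)"
      using t by (subst eq[symmetric]) (auto intro!: nn_integral_cong simp: indicator_def)
    also have "\<dots> = ennreal (G t) + (\<integral>\<^sup>+s\<in>{t..<2*t}. v s \<partial>lborel)"
      using t by (subst nn_integral_add) (auto simp: eq)
    finally have e: "ennreal (G (2 * t)) = ennreal (G t) + (\<integral>\<^sup>+s\<in>{t..<2*t}. v s \<partial>lborel)" .
    then have "(\<integral>\<^sup>+s\<in>{t..<2*t}. v s \<partial>lborel) = ennreal (G (2 * t)) - ennreal (G t)" by simp
    also have "\<dots> = ennreal (G (2 * t) - G t)" using G(2)[OF t] by (simp add: ennreal_minus)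
    finally show ?thesis unfolding k0_def using t
      by (simp add: ennreal_mult'[symmetric])
  qed
  show "antimono k"
  proof (rule antimonoI)
    fix s t :: real assume "s \<le> t"
    then show "k t \<le> k s"
      using concave_slope_antimono[OF G(1), of s t] by (auto simp: k_def k0 intro!: ennreal_leI)
  qed
  fix x :: real assume x: "0 < x"
  note avg = nn_integral_dyadic_average[OF assms(1) x, folded k0_def]
  show "(\<integral>\<^sup>+s\<in>{0<..<x}. v s \<partial>lborel) \<le> 2 * (\<integral>\<^sup>+t\<in>{0<..<x}. k t \<partial>lborel)"
    unfolding k_eq by (rule avg(1))
  have "(\<integral>\<^sup>+t\<in>{0<..<x}. k t \<partial>lborel) \<le> ennreal (G (2 * x))"
    unfolding k_eq using avg(2) x by (simp add: eq)
  also have "\<dots> \<le> ennreal (3 * G x)"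
    by (intro ennreal_leI concave_nonneg_double_le G x)
  also have "\<dots> = 3 * (\<integral>\<^sup>+s\<in>{0<..<x}. v s \<partial>lborel)"
    using G(2)[OF x] x by (simp add: eq ennreal_mult)
  finally show "(\<integral>\<^sup>+t\<in>{0<..<x}. k t \<partial>lborel) \<le> 3 * (\<integral>\<^sup>+s\<in>{0<..<x}. v s \<partial>lborel)" .
qed

subsection \<open>Weighted Hardy inequality\<close>

lemma conjugate_exponent_gt_1:
  fixes p p' :: real
  assumes "1 < p" "1 / p + 1 / p' = 1"
  shows "1 < p'"
proof -
  have "0 < 1 / p" "1 / p < 1" using assms(1) by auto
  then have "0 < 1 / p'" "1 / p' < 1" using assms(2) by linarith+
  then show ?thesis by (simp add: zero_less_divide_iff divide_less_eq split: if_splits)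
qed

section \<open>Hoelder's inequality with a weight\<close>

text \<open>If the first term falls short of h, then h^(p-1) < 1 / (s^p w), and raising this to the
  power p' - 1 = 1/(p-1) bounds h by the second term. For w = 0 the second term is infinite; for w =
  \<infinity> the first is, unless h = 0. The free parameter \<open>s\<close> is optimised only
  after integration.\<close>

lemma young_weighted:
  fixes h w :: ennreal
  assumes p: "1 < p" "1 / p + 1 / p' = 1" and s: "0 < s"
  shows "h \<le> ennreal (s powr p) * (h epowr p * w) + ennreal (s powr (- p')) * w epowr (1 - p')"
proof -
  have p': "1 < p'" by (rule conjugate_exponent_gt_1[OF p])
  have pp: "p + p' = p * p'" using p p' by (simp add: field_simps)
  have sp: "ennreal (s powr a) \<noteq> 0" for a using s by (simp add: ennreal_eq_0_iff)
  show ?thesis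
  proof (cases w)
    case top
    then show ?thesis using sp[of p] p by (cases "h = 0") (auto simp: ennreal_mult_top epowr_eq_0_iff)
  next
    case (real v)
    show ?thesis
    proof (cases "v = 0")
      case True
      then have "w epowr (1 - p') = top" using real p' by (simp add: epowr_def)
      then show ?thesis using sp[of "- p'"] by (simp add: ennreal_mult_top)
    next
      case False
      then have v: "0 < v" using real by simp
      then have we: "w epowr (1 - p') = ennreal (v powr (1 - p'))"
        using real p' by (simp add: epowr_def ennreal_eq_0_iff)
      show ?thesis
      proof (cases h)
        case top
        then show ?thesis using sp[of p] p real v by (simp add: ennreal_mult_top ennreal_top_mult)
      next
        case (real r)
        have "r \<le> s powr p * (r powr p * v) + s powr (- p') * v powr (1 - p')"
        proof (cases "r \<le> s powr p * (r powr p * v)")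
          case True
          then show ?thesis by (simp add: add_increasing2)
        next
          case False
          have r: "0 < r" using False real s v by (cases "r = 0") auto
          have "s powr p * v * r powr (p - 1) < 1"
          proof -
            have "r powr p = r powr (p - 1) * r" using powr_add[of r "p - 1" 1] r by simp
            then have "(s powr p * v * r powr (p - 1)) * r < 1 * r" using False by (simp add: mult_ac)
            then show ?thesis using r by (simp only: mult_less_cancel_right_pos)
          qed
          then have "r powr (p - 1) \<le> 1 / (s powr p * v)"
            using s v by (simp add: field_simps)
          then have "(r powr (p - 1)) powr (p' - 1) \<le> (1 / (s powr p * v)) powr (p' - 1)"
            using p' by (intro powr_mono2) auto
          also have "(r powr (p - 1)) powr (p' - 1) = r"
          proof -
            have "(p - 1) * (p' - 1) = 1" using pp by (simp add: algebra_simps)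
            then show ?thesis using r by (simp add: powr_powr)
          qed
          also have "(1 / (s powr p * v)) powr (p' - 1) = s powr (- p') * v powr (1 - p')"
          proof -
            have "(1 / (s powr p * v)) powr (p' - 1) = (s powr p * v) powr (1 - p')"
              using powr_minus_divide[of "s powr p * v" "p' - 1"] s v by (simp add: powr_divide)
            also have "\<dots> = s powr (p * (1 - p')) * v powr (1 - p')"
              using s v by (simp add: powr_mult powr_powr)
            also have "p * (1 - p') = - p'" using pp by (simp add: algebra_simps)
            finally show ?thesis .
          qed
          finally show ?thesis using s v r by (intro add_increasing) auto
        qed
        then have "ennreal r \<le> ennreal (s powr p * (r powr p * v) + s powr (- p') * v powr (1 - p'))"
          by (rule ennreal_leI)
        then show ?thesis unfolding we using real \<open>w = ennreal v\<close> v p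
          by (simp add: ennreal_epowr ennreal_mult)
      qed
    qed
  qed
qed

text \<open>The optimal \<open>s\<close> exists only for positive coefficients, so both are first
  enlarged to a + 1/(n+1) and W + 1/(n+1), and the bound passes to the limit.\<close>

lemma le_geometric_mean_of_le_sum:
  fixes a W I :: real
  assumes p: "1 < p" "1 / p + 1 / p' = 1" and "0 \<le> a" "0 \<le> W"
    and le: "\<And>s. 0 < s \<Longrightarrow> I \<le> s powr p * a + s powr (- p') * W"
  shows "I \<le> 2 * a powr (1 / p) * W powr (1 / p')"
proof -
  have p': "0 < p'" using conjugate_exponent_gt_1[OF p] by simp
  have pos: "I \<le> 2 * b powr (1 / p) * V powr (1 / p')" if "a < b" "W < V" for b V
  proof -
    have b: "0 < b" "0 < V" using that assms by auto
    \<comment> \<open>This choice balances the two terms: each becomes b^(1/p) V^(1/p'), whence the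
      factor 2.\<close>
    define s where "s = (V / b) powr (1 / (p * p'))"
    have s: "0 < s" using b unfolding s_def by simp
    have "I \<le> s powr p * b + s powr (- p') * V"
      using le[OF s] that by (smt (verit) mult_left_mono powr_ge_zero)
    also have "s powr p = (V / b) powr (1 / p')"
      unfolding s_def using p p' by (simp add: powr_powr)
    also have "s powr (- p') = (V / b) powr (- 1 / p)"
      unfolding s_def using p p' by (simp add: powr_powr)
    also have "(V / b) powr (1 / p') * b = V powr (1 / p') * b powr (1 / p)"
    proof -
      have "b = b powr (1 / p) * b powr (1 / p')" using powr_add[of b "1 / p" "1 / p'"] p b by simp
      then have "(V / b) powr (1 / p') * b = V powr (1 / p') / b powr (1 / p') * (b powr (1 / p) * b powr (1 / p'))"
        using b by (simp add: powr_divide)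
      then show ?thesis using b by simp
    qed
    also have "(V / b) powr (- 1 / p) * V = V powr (1 / p') * b powr (1 / p)"
    proof -
      have "V = V powr (1 / p) * V powr (1 / p')" using powr_add[of V "1 / p" "1 / p'"] p b by simp
      then have "(V / b) powr (- 1 / p) * V = b powr (1 / p) / V powr (1 / p) * (V powr (1 / p) * V powr (1 / p'))"
        using b by (simp add: powr_divide powr_minus_divide)
      then show ?thesis using b by simp
    qed
    finally show ?thesis by (simp add: mult_ac)
  qed
  have "(\<lambda>n. 2 * (a + 1 / Suc n) powr (1 / p) * (W + 1 / Suc n) powr (1 / p'))
      \<longlonglongrightarrow> 2 * (a + 0) powr (1 / p) * (W + 0) powr (1 / p')"
    using assms p' by (intro tendsto_intros tendsto_powr' LIMSEQ_Suc[OF lim_1_over_n]) auto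
  then show ?thesis
    by (intro LIMSEQ_le_const[where X="\<lambda>n. 2 * (a + 1 / Suc n) powr (1 / p) * (W + 1 / Suc n) powr (1 / p')"])
       (auto intro!: exI[of _ 0] pos)
qed

text \<open>The multiplier \<open>c\<close> is carried along to handle infinite dual integrals: the
  bound \<open>A\<close> then forces c = 0, and the left side vanishes by 0 * \<infinity> =
  0.\<close>

lemma nn_integral_weighted_Hoelder_le:
  fixes h w :: "'a \<Rightarrow> ennreal"
  assumes p: "1 < p" "1 / p + 1 / p' = 1"
    and [measurable]: "h \<in> borel_measurable M" "w \<in> borel_measurable M" "E \<in> sets M"
    and A: "0 < A" and c: "c * (\<integral>\<^sup>+t\<in>E. w t epowr (1 - p') \<partial>M) epowr (1 / p') \<le> ennreal A"
  shows "c * (\<integral>\<^sup>+t\<in>E. h t \<partial>M) \<le> ennreal (2 * A) * (\<integral>\<^sup>+t\<in>E. h t epowr p * w t \<partial>M) epowr (1 / p)"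
proof -
  define a where "a = (\<integral>\<^sup>+t\<in>E. h t epowr p * w t \<partial>M)"
  define W where "W = (\<integral>\<^sup>+t\<in>E. w t epowr (1 - p') \<partial>M)"
  define I where "I = (\<integral>\<^sup>+t\<in>E. h t \<partial>M)"
  have p': "0 < p'" using conjugate_exponent_gt_1[OF p] by simp
  have I: "I \<le> ennreal (s powr p) * a + ennreal (s powr (- p')) * W" if "0 < s" for s
  proof -
    have "I \<le> (\<integral>\<^sup>+t. (ennreal (s powr p) * (h t epowr p * w t * indicator E t)
        + ennreal (s powr (- p')) * (w t epowr (1 - p') * indicator E t)) \<partial>M)"
      unfolding I_def using young_weighted[OF p that]
      by (intro nn_integral_mono) (auto simp: indicator_def)
    also have "\<dots> = ennreal (s powr p) * a + ennreal (s powr (- p')) * W"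
      unfolding a_def W_def by (simp add: nn_integral_add nn_integral_cmult)
    finally show ?thesis .
  qed
  consider "W = top" | "a = top" | "W \<noteq> top" "a \<noteq> top" by blast
  then have "c * I \<le> ennreal (2 * A) * a epowr (1 / p)"
  proof cases
    case 1
    have "c = 0"
    proof (rule ccontr)
      assume "c \<noteq> 0"
      then have "c * W epowr (1 / p') = top" using 1 p' by (simp add: ennreal_mult_top)
      then show False using c unfolding W_def[symmetric] by (simp add: top_unique)
    qed
    then show ?thesis by simp
  next
    case 2
    then show ?thesis using A p by (simp add: ennreal_mult_top ennreal_eq_0_iff)
  next
    case 3
    obtain ar where ar: "0 \<le> ar" "a = ennreal ar" using 3 by (cases a) auto
    obtain Wr where Wr: "0 \<le> Wr" "W = ennreal Wr" using 3 by (cases W) auto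
    have "I \<le> ennreal (s powr p * ar + s powr (- p') * Wr)" if "0 < s" for s
      using I[OF that] ar Wr by (simp add: ennreal_mult)
    note Ir = this
    obtain i where i: "0 \<le> i" "I = ennreal i" using Ir[of 1] by (cases I) (auto simp: top_unique)
    have "i \<le> s powr p * ar + s powr (- p') * Wr" if "0 < s" for s
      using Ir[OF that] ar(1) Wr(1) unfolding i(2) by (subst (asm) ennreal_le_iff) auto
    then have "i \<le> 2 * ar powr (1 / p) * Wr powr (1 / p')"
      by (rule le_geometric_mean_of_le_sum[OF p ar(1) Wr(1)])
    then have "ennreal i \<le> ennreal (2 * ar powr (1 / p) * Wr powr (1 / p'))" by (rule ennreal_leI)
    also have "\<dots> = 2 * a epowr (1 / p) * W epowr (1 / p')"
      using ar Wr p p' by (simp add: ennreal_epowr ennreal_mult)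
    finally have "c * I \<le> c * (2 * a epowr (1 / p) * W epowr (1 / p'))"
      unfolding i(2) by (rule mult_left_mono) simp
    also have "\<dots> = 2 * a epowr (1 / p) * (c * W epowr (1 / p'))" by (simp add: mult_ac)
    also have "\<dots> \<le> 2 * a epowr (1 / p) * ennreal A"
      using c unfolding W_def by (rule mult_left_mono) simp
    also have "\<dots> = ennreal (2 * A) * a epowr (1 / p)" using A by (simp add: ennreal_mult mult_ac)
    finally show ?thesis .
  qed
  then show ?thesis unfolding I_def a_def .
qed

text \<open>Each term satisfies a^r = a * a^(r-1), and r \<ge> 1 allows the second factor to be
  bounded by the power of the full sum.\<close>

lemma suminf_epowr_le:
  fixes a :: "nat \<Rightarrow> ennreal"
  assumes r: "1 \<le> r"
  shows "(\<Sum>n. a n epowr r) \<le> (\<Sum>n. a n) epowr r"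
proof -
  have single: "a n \<le> (\<Sum>n. a n)" for n
    using sum_le_suminf[of a "{n}"] by simp
  have split: "x epowr r = x * x epowr (r - 1)" for x :: ennreal
    using epowr_add[of 1 "r - 1" x] r by simp
  have "(\<Sum>n. a n epowr r) \<le> (\<Sum>n. a n * (\<Sum>n. a n) epowr (r - 1))"
    unfolding split using r by (intro suminf_le mult_left_mono epowr_mono single) auto
  also have "\<dots> = (\<Sum>n. a n) epowr r"
    unfolding split by (rule ennreal_suminf_multc)
  finally show ?thesis .
qed

text \<open>\<open>H\<close> is the distribution function of the finite measure with density
  \<open>h\<close> on the positive axis, which has no atoms. Continuity is what lets the Hardy
  inequality find points where \<open>H\<close> equals a power of two.\<close>

lemma continuous_primitive:
  fixes h :: "real \<Rightarrow> ennreal"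
  assumes [measurable]: "h \<in> borel_measurable borel" and fin: "(\<integral>\<^sup>+t\<in>{0<..}. h t \<partial>lborel) < top"
  defines "H \<equiv> \<lambda>x. enn2real (\<integral>\<^sup>+t\<in>{0<..<x}. h t \<partial>lborel)"
  shows "continuous_on UNIV H"
proof -
  define M where "M = density lborel (\<lambda>t. h t * indicator {0<..} t)"
  have eM: "emeasure M S = (\<integral>\<^sup>+t\<in>S. (h t * indicator {0<..} t) \<partial>lborel)" if "S \<in> sets borel" for S
    unfolding M_def using that by (subst emeasure_density) auto
  interpret finite_borel_measure M
  proof (intro finite_borel_measure.intro finite_borel_measure_axioms.intro finite_measureI)
    show "sets M = sets borel" by (simp add: M_def)
    show "emeasure M (space M) \<noteq> \<infinity>"
      using fin eM[of UNIV] by (simp add: M_def)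
  qed
  have H: "H x = cdf M x" for x
  proof -
    have "(\<integral>\<^sup>+t\<in>{0<..<x}. h t \<partial>lborel) = emeasure M {..x}"
      unfolding eM[OF borel_closed[OF closed_atMost]]
    proof (rule nn_integral_cong_AE)
      show "AE t in lborel. h t * indicator {0<..<x} t = h t * indicator {0<..} t * indicator {..x} t"
        using AE_lborel_singleton[of x] by eventually_elim (auto simp: indicator_def)
    qed
    then show ?thesis unfolding H_def cdf_def2 measure_def by simp
  qed
  have "emeasure M {x} = 0" for x
  proof -
    have "emeasure M {x} = (\<integral>\<^sup>+t. 0 \<partial>(lborel :: real measure))"
      unfolding eM[OF borel_closed[OF closed_singleton]]
    proof (rule nn_integral_cong_AE)
      show "AE t in lborel. h t * indicator {0<..} t * indicator {x} t = 0"
        using AE_lborel_singleton[of x] by eventually_elim (auto simp: indicator_def)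
    qed
    then show ?thesis by simp
  qed
  then have "isCont H x" for x
    unfolding H by (subst isCont_cdf) (simp add: measure_def)
  then show ?thesis by (simp add: continuous_on_eq_continuous_at)
qed

text \<open>Blocking argument: the points at which the primitive of \<open>h\<close> equals a power of two
  split the half-line into disjoint intervals, on each of which the weighted Hoelder inequality applies.\<close>

theorem weighted_Hardy_inequality:
  fixes h w k :: "real \<Rightarrow> ennreal"
  assumes p: "1 < p" "p \<le> q" "1 / p + 1 / p' = 1" and A: "0 < A"
    and hm [measurable]: "h \<in> borel_measurable borel" and [measurable]: "w \<in> borel_measurable borel" "k \<in> borel_measurable borel"
    and fin: "(\<integral>\<^sup>+t\<in>{0<..}. h t \<partial>lborel) < top"
    and cond: "\<And>x. 0 < x \<Longrightarrow> (\<integral>\<^sup>+t\<in>{0<..<1/x}. k t \<partial>lborel) epowr (1 / q) *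
        (\<integral>\<^sup>+t\<in>{0<..<x}. w t epowr (1 - p') \<partial>lborel) epowr (1 / p') \<le> ennreal A"
  shows "(\<integral>\<^sup>+t\<in>{0<..}. (\<integral>\<^sup>+s\<in>{0<..<1/t}. h s \<partial>lborel) epowr q * k t \<partial>lborel)
    \<le> ennreal (8 * A) epowr q * (\<integral>\<^sup>+t\<in>{0<..}. h t epowr p * w t \<partial>lborel) epowr (q / p)"
proof -
  have q: "0 < q" "1 \<le> q / p" using p by auto
  have p': "0 < p'" using conjugate_exponent_gt_1[OF p(1,3)] by simp
  define He where "He x = (\<integral>\<^sup>+t\<in>{0<..<x}. h t \<partial>lborel)" for x
  define H where "H x = enn2real (He x)" for x
  have He_fin: "He x < top" for x
  proof -
    have "He x \<le> (\<integral>\<^sup>+t\<in>{0<..}. h t \<partial>lborel)"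
      unfolding He_def by (intro nn_integral_mono) (auto simp: indicator_def)
    then show ?thesis using fin by (rule le_less_trans)
  qed
  have HeH: "He x = ennreal (H x)" for x unfolding H_def using He_fin[of x] by simp
  have H_nn: "0 \<le> H x" for x unfolding H_def by simp
  have H_mono: "H x \<le> H y" if "x \<le> y" for x y
    unfolding H_def
  proof (rule enn2real_mono)
    show "He x \<le> He y" unfolding He_def using that by (intro nn_integral_mono) (auto simp: indicator_def)
  qed (rule He_fin)
  have H_less: "x < y" if "H x < H y" for x y
    using H_mono[of y x] that by (meson not_le)
  have H_cont: "continuous_on UNIV H"
    using continuous_primitive[OF hm fin] unfolding H_def[abs_def] He_def .
  have H0: "H 0 = 0" unfolding H_def He_def by simp
  have ivt: "\<exists>x>0. H x = c" if c: "0 < c" "c \<le> H y" "0 < y" for c y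
  proof -
    obtain x where x: "0 \<le> x" "x \<le> y" "H x = c"
      using IVT'[of H 0 c y] c H0 continuous_on_subset[OF H_cont subset_UNIV] by auto
    then have "x \<noteq> 0" using c H0 by auto
    then show ?thesis using x by (intro exI[of _ x]) auto
  qed
  \<comment> \<open>\<open>H\<close> is bounded, so only some powers of two are attained;
    \<open>J\<close> collects their exponents. It is closed under j -> j - 1 because
    \<open>H\<close> is continuous with H 0 = 0.\<close>
  define J where "J = {j::int. \<exists>x>0. H x = 2 powr j}"
  define X where "X j = (SOME x. 0 < x \<and> H x = 2 powr j)" for j :: int
  have X: "0 < X j" "H (X j) = 2 powr j" if "j \<in> J" for j
    using someI_ex[of "\<lambda>x. 0 < x \<and> H x = 2 powr j"] that unfolding J_def X_def by auto
  have J_pred: "j - 1 \<in> J" if "j \<in> J" for j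
    using ivt[of "2 powr (real_of_int (j - 1))" "X j"] X[OF that] unfolding J_def by (simp add: powr_mono)
  have X_mono: "X i \<le> X j" if "i \<in> J" "j \<in> J" "i \<le> j" for i j
  proof (cases "i = j")
    case False
    then have "H (X i) < H (X j)" using that X by (simp add: powr_less_mono)
    then show ?thesis using H_less by (simp add: less_imp_le)
  qed simp
  \<comment> \<open>The block lies to the left of \<open>X j\<close>, since the next level 2^(j+1)
    need not be attained. Over it \<open>h\<close> has integral exactly 2^j - 2^(j-1) =
    2^(j-1).\<close>
  define E where "E j = (if j \<in> J then {X (j - 1)..<X j} else {})" for j
  have [measurable]: "E j \<in> sets borel" for j unfolding E_def by simp
  define a where "a j = (\<integral>\<^sup>+t\<in>E j. (h t epowr p * w t) \<partial>lborel)" for j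
  define K where "K j = (\<integral>\<^sup>+t\<in>{0<..<1 / X j}. k t \<partial>lborel)" for j
  \<comment> \<open>Since 2^(j+1) is 4 times the integral of \<open>h\<close> over
    \<open>E j\<close>, the factor 2 A from Hoelder becomes 8 A.\<close>
  have block: "ennreal (2 powr (j + 1)) epowr q * K j \<le> ennreal (8 * A) epowr q * a j epowr (q / p)"
    if j: "j \<in> J" for j
  proof -
    note j1 = J_pred[OF j]
    have le: "X (j - 1) \<le> X j" using X_mono[OF j1 j] by simp
    have "He (X j) = (\<integral>\<^sup>+t. (h t * indicator {0<..<X (j - 1)} t + h t * indicator (E j) t) \<partial>lborel)"
      unfolding He_def using X(1)[OF j1] le j by (intro nn_integral_cong) (auto simp: E_def indicator_def)
    also have "\<dots> = He (X (j - 1)) + (\<integral>\<^sup>+t\<in>E j. h t \<partial>lborel)"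
      unfolding He_def by (rule nn_integral_add) auto
    finally have "(\<integral>\<^sup>+t\<in>E j. h t \<partial>lborel) = ennreal (H (X j)) - ennreal (H (X (j - 1)))"
      unfolding HeH by simp
    also have "\<dots> = ennreal (2 powr (j - 1))"
    proof -
      have "(2::real) powr j = 2 * 2 powr (j - 1)" using powr_add[of 2 1 "real_of_int (j - 1)"] by simp
      then show ?thesis using X[OF j] X[OF j1] by (simp add: ennreal_minus)
    qed
    finally have I: "(\<integral>\<^sup>+t\<in>E j. h t \<partial>lborel) = ennreal (2 powr (j - 1))" .
    have "K j epowr (1 / q) * (\<integral>\<^sup>+t\<in>E j. w t epowr (1 - p') \<partial>lborel) epowr (1 / p')
      \<le> K j epowr (1 / q) * (\<integral>\<^sup>+t\<in>{0<..<X j}. w t epowr (1 - p') \<partial>lborel) epowr (1 / p')"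
      using p' X(1)[OF j1] by (intro mult_left_mono epowr_mono nn_integral_mono) (auto simp: E_def indicator_def)
    also have "\<dots> \<le> ennreal A" unfolding K_def by (rule cond) (rule X[OF j])
    finally have "K j epowr (1 / q) * (\<integral>\<^sup>+t\<in>E j. h t \<partial>lborel) \<le> ennreal (2 * A) * a j epowr (1 / p)"
      unfolding a_def by (intro nn_integral_weighted_Hoelder_le[OF p(1,3) _ _ _ A]) auto
    then have "ennreal 4 * (K j epowr (1 / q) * ennreal (2 powr (j - 1))) \<le> ennreal 4 * (ennreal (2 * A) * a j epowr (1 / p))"
      unfolding I by (rule mult_left_mono) simp
    also have "ennreal 4 * (ennreal (2 * A) * a j epowr (1 / p)) = ennreal (8 * A) * a j epowr (1 / p)"
      using A ennreal_mult[of 4 "2 * A"] by (simp add: mult.assoc[symmetric])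
    also have "ennreal 4 * (K j epowr (1 / q) * ennreal (2 powr (j - 1))) = ennreal (2 powr (j + 1)) * K j epowr (1 / q)"
    proof -
      have "(2::real) powr (j + 1) = 4 * 2 powr (j - 1)" using powr_add[of 2 2 "real_of_int (j - 1)"] by (simp add: add.commute)
      then have "ennreal (2 powr (j + 1)) = ennreal 4 * ennreal (2 powr (j - 1))"
        using ennreal_mult[of 4 "2 powr real_of_int (j - 1)"] by simp
      then show ?thesis by (simp add: mult_ac)
    qed
    finally have "(ennreal (2 powr (j + 1)) * K j epowr (1 / q)) epowr q \<le> (ennreal (8 * A) * a j epowr (1 / p)) epowr q"
      using q by (intro epowr_mono) auto
    then show ?thesis using q p by (simp add: epowr_mult epowr_epowr)
  qed
  define d where "d j = (if j \<in> J then ennreal (2 powr (j + 1)) epowr q * K j else 0)" for j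
  have d_le: "d j \<le> ennreal (8 * A) epowr q * a j epowr (q / p)" for j
    using block[of j] unfolding d_def by auto
  have disj: "disjoint_family (\<lambda>n. E (int_decode n))"
  proof -
    have "E i \<inter> E j = {}" if "i < j" for i j
    proof (cases "i \<in> J \<and> j \<in> J")
      case True
      then have "X i \<le> X (j - 1)" using that J_pred[of j] by (intro X_mono) auto
      then show ?thesis by (auto simp: E_def)
    qed (auto simp: E_def)
    then have "E i \<inter> E j = {}" if "i \<noteq> j" for i j
      using that by (metis Int_commute linorder_neqE)
    then show ?thesis unfolding disjoint_family_on_def by (simp add: int_decode_eq)
  qed
  have sum_a: "(\<Sum>n. a (int_decode n)) \<le> (\<integral>\<^sup>+t\<in>{0<..}. h t epowr p * w t \<partial>lborel)"
  proof -
    have "(\<Sum>n. a (int_decode n)) = (\<integral>\<^sup>+t\<in>(\<Union>n. E (int_decode n)). h t epowr p * w t \<partial>lborel)"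
      unfolding a_def by (rule nn_integral_disjoint_family[symmetric, OF _ _ disj]) auto
    also have "\<dots> \<le> (\<integral>\<^sup>+t\<in>{0<..}. h t epowr p * w t \<partial>lborel)"
    proof (rule nn_integral_mono)
      fix t
      have "0 < t" if "t \<in> E j" for j
        using that X(1)[OF J_pred[of j]] by (auto simp: E_def split: if_splits)
      then show "h t epowr p * w t * indicator (\<Union>n. E (int_decode n)) t \<le> h t epowr p * w t * indicator {0<..} t"
        by (auto simp: indicator_def)
    qed
    finally show ?thesis .
  qed
  \<comment> \<open>The intervals (0, 1 / X j) overlap, so the sum over \<open>j\<close> overcounts.
    This is harmless, because each term is bounded through its own block \<open>E j\<close>, and the
    blocks are disjoint.\<close>
  define g where "g j t = (if j \<in> J then ennreal (2 powr (j + 1)) epowr q * (k t * indicator {0<..<1 / X j} t) else 0)" for j t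
  have [measurable]: "g j \<in> borel_measurable borel" for j unfolding g_def by measurable
  have "(\<integral>\<^sup>+t\<in>{0<..}. He (1 / t) epowr q * k t \<partial>lborel) \<le> (\<integral>\<^sup>+t. (\<Sum>n. g (int_decode n) t) \<partial>lborel)"
  proof (rule nn_integral_mono)
    fix t :: real
    show "He (1 / t) epowr q * k t * indicator {0<..} t \<le> (\<Sum>n. g (int_decode n) t)"
    proof (cases "0 < t \<and> H (1 / t) \<noteq> 0")
      case True
      then have t: "0 < t" and Ht: "0 < H (1 / t)" using H_nn[of "1 / t"] by auto
      \<comment> \<open>The ceiling is chosen so that 2^j < H(1/t) \<le> 2^(j+1). The strict lower
        bound yields X j < 1/t, hence t < 1 / X j; the upper bound is the coefficient in
        \<open>g\<close>.\<close>
      define j where "j = \<lceil>log 2 (H (1 / t))\<rceil> - 1"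
      have j: "real_of_int j < log 2 (H (1 / t))" "log 2 (H (1 / t)) \<le> real_of_int j + 1"
        unfolding j_def by linarith+
      have lo: "2 powr j < H (1 / t)" using j(1) Ht by (simp add: less_log_iff)
      have hi: "H (1 / t) \<le> 2 powr (j + 1)" using j(2) Ht by (simp add: log_le_iff)
      have jJ: "j \<in> J" using ivt[of "2 powr j" "1 / t"] lo t unfolding J_def by simp
      have "X j < 1 / t" using lo X(2)[OF jJ] by (simp add: H_less)
      then have "t < 1 / X j" using t X(1)[OF jJ] by (simp add: field_simps)
      then have "He (1 / t) epowr q * k t \<le> g j t"
        unfolding g_def HeH using jJ t hi q
        by (auto intro!: mult_right_mono epowr_mono ennreal_leI)
      also have "\<dots> = g (int_decode (int_encode j)) t" by simp
      also have "\<dots> \<le> (\<Sum>n. g (int_decode n) t)"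
        using sum_le_suminf[of "\<lambda>n. g (int_decode n) t" "{int_encode j}"] by simp
      finally show ?thesis using t by simp
    next
      case False
      then show ?thesis using q by (auto simp: HeH)
    qed
  qed
  also have "\<dots> = (\<Sum>n. \<integral>\<^sup>+t. g (int_decode n) t \<partial>lborel)"
    by (rule nn_integral_suminf) measurable
  also have "(\<lambda>n. \<integral>\<^sup>+t. g (int_decode n) t \<partial>lborel) = (\<lambda>n. d (int_decode n))"
    unfolding g_def d_def K_def by (auto simp: nn_integral_cmult)
  also have "(\<Sum>n. d (int_decode n)) \<le> (\<Sum>n. ennreal (8 * A) epowr q * a (int_decode n) epowr (q / p))"
    by (intro suminf_le d_le) auto
  also have "\<dots> = ennreal (8 * A) epowr q * (\<Sum>n. a (int_decode n) epowr (q / p))"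
    by (rule ennreal_suminf_cmult)
  \<comment> \<open>The hypothesis p \<le> q enters here: the exponent q/p is at least 1, so the
    power can be taken outside the sum.\<close>
  also have "\<dots> \<le> ennreal (8 * A) epowr q * (\<Sum>n. a (int_decode n)) epowr (q / p)"
    by (intro mult_left_mono suminf_epowr_le q) simp
  also have "\<dots> \<le> ennreal (8 * A) epowr q * (\<integral>\<^sup>+t\<in>{0<..}. h t epowr p * w t \<partial>lborel) epowr (q / p)"
    using q by (intro mult_left_mono epowr_mono sum_a) auto
  finally show ?thesis unfolding He_def .
qed

subsection \<open>Weighted Fourier inequality\<close>

lemma weight_obtain_borel:
  assumes "weight u"
  obtains v where "v \<in> borel_measurable borel" "AE t in lborel. 0 < t \<longrightarrow> u t = v t"
proof -
  have "(\<lambda>t. u t * indicator {0<..} t) \<in> borel_measurable lebesgue"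
    using assms unfolding weight_def
    by (subst (asm) borel_measurable_restrict_space_iff_ennreal) auto
  then obtain v where v: "v \<in> borel_measurable lborel" "AE t in lborel. u t * indicator {0<..} t = v t"
    using completion_ex_borel_measurable by blast
  have "AE t in lborel. 0 < t \<longrightarrow> u t = v t"
    using v(2) by eventually_elim auto
  then show ?thesis using v(1) that by simp
qed

lemma set_nn_integral_lebesgue_cong:
  assumes "AE t in lborel. 0 < t \<longrightarrow> f t = g t" "S \<subseteq> {0<..}"
  shows "(\<integral>\<^sup>+t\<in>S. f t \<partial>lebesgue) = (\<integral>\<^sup>+t\<in>S. g t \<partial>(lborel :: real measure))"
  unfolding nn_integral_completion
proof (rule nn_integral_cong_AE)
  show "AE t in lborel. f t * indicator S t = g t * indicator S t"
    using assms(1) by eventually_elim (use assms(2) in \<open>auto simp: indicator_def\<close>)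
qed

text \<open>Changing \<open>f\<close> on a null set leaves every value of the transform and of the
  distribution function unchanged, so both are literally the same functions for \<open>g\<close>.
  The representative is built from real and imaginary parts.\<close>

lemma lebesgue_integrable_obtain_borel:
  fixes f :: "'a::euclidean_space \<Rightarrow> complex"
  assumes f: "integrable lebesgue f"
  obtains g where "integrable lborel g" "rearrangement f = rearrangement g" "fourier f = fourier g"
proof -
  have fm [measurable]: "f \<in> borel_measurable lebesgue" using f by auto
  have "(\<lambda>x. Re (f x)) \<in> borel_measurable lebesgue" "(\<lambda>x. Im (f x)) \<in> borel_measurable lebesgue"
    by measurable
  then obtain a b where a [measurable]: "a \<in> borel_measurable borel" "AE x in lborel. Re (f x) = a x"
    and b [measurable]: "b \<in> borel_measurable borel" "AE x in lborel. Im (f x) = b x"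
    using completion_ex_borel_measurable_real[of "\<lambda>x. Re (f x)" lborel]
      completion_ex_borel_measurable_real[of "\<lambda>x. Im (f x)" lborel] by auto
  define g where "g x = complex_of_real (a x) + \<i> * complex_of_real (b x)" for x
  have gm [measurable]: "g \<in> borel_measurable borel" unfolding g_def by measurable
  have gl [measurable]: "g \<in> borel_measurable lebesgue" by (rule measurable_completion) simp
  have "AE x in lborel. f x = g x"
    using a(2) b(2) by eventually_elim (simp add: g_def complex_eq_iff)
  then have AE: "AE x in lebesgue. f x = g x" by (rule AE_completion)
  have "integrable lebesgue g"
    using f integrable_cong_AE[OF fm gl AE] by simp
  then have "integrable lborel g" by (simp add: integrable_completion)
  moreover have "distribution_fun f \<alpha> = distribution_fun g \<alpha>" for \<alpha>
    unfolding distribution_fun_def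
  proof (rule emeasure_eq_AE)
    show "AE x in lebesgue. (x \<in> {x. \<alpha> < norm (f x)}) = (x \<in> {x. \<alpha> < norm (g x)})"
      using AE by eventually_elim simp
    have "{x \<in> space lebesgue. \<alpha> < norm (f x)} \<in> sets lebesgue" by measurable
    then show "{x. \<alpha> < norm (f x)} \<in> sets lebesgue" by simp
    have "{x \<in> space lebesgue. \<alpha> < norm (g x)} \<in> sets lebesgue" by measurable
    then show "{x. \<alpha> < norm (g x)} \<in> sets lebesgue" by simp
  qed
  then have "rearrangement f = rearrangement g" by (auto simp: rearrangement_def)
  moreover have "fourier f x = fourier g x" for x
    unfolding fourier_def fourier_kernel_def[symmetric]
  proof (rule integral_cong_AE)
    have [measurable]: "fourier_kernel x \<in> borel_measurable lebesgue"
      by (rule measurable_completion) measurable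
    show "(\<lambda>y. fourier_kernel x y * f y) \<in> borel_measurable lebesgue" by measurable
    show "(\<lambda>y. fourier_kernel x y * g y) \<in> borel_measurable lebesgue" by measurable
    show "AE y in lebesgue. fourier_kernel x y * f y = fourier_kernel x y * g y"
      using AE by eventually_elim simp
  qed
  ultimately show ?thesis using that by auto
qed

text \<open>The L1 norm bounds the transform everywhere. The added 1 keeps the level positive, as
  the infimum defining the rearrangement requires, even when the norm is 0.\<close>

lemma rearrangement_fourier_bounded:
  fixes f :: "'a::euclidean_space \<Rightarrow> complex"
  assumes f: "integrable lborel f"
  shows "rearrangement (fourier f) t \<le> ennreal ((LINT x|lborel. norm (f x)) + 1)"
proof (rule rearrangement_le)
  have fm: "f \<in> borel_measurable borel" using f by auto
  have B: "0 \<le> (LINT x|lborel. norm (f x))" by simp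
  then show "0 < (LINT x|lborel. norm (f x)) + 1" by linarith
  have "norm (fourier f x) \<le> (LINT x|lborel. norm (f x))" for x
    unfolding fourier_eq_lborel[OF fm]
    using integral_norm_bound[of lborel "\<lambda>y. fourier_kernel x y * f y"] by (simp add: norm_mult)
  then have "\<not> (LINT x|lborel. norm (f x)) + 1 < norm (fourier f x)" for x
    by (smt (verit))
  then have "distribution_fun (fourier f) ((LINT x|lborel. norm (f x)) + 1) = 0"
    unfolding distribution_fun_def by simp
  then show "distribution_fun (fourier f) ((LINT x|lborel. norm (f x)) + 1) \<le> ennreal t" by simp
qed

text \<open>With a finite majorant, its concavity yields \<open>k\<close>, and
  \<open>primitive u \<le> primitive uo\<close> transfers the lower bound to \<open>u\<close>.
  Without one, \<open>primitive uo\<close> is infinite and the constant \<open>top\<close> satisfies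
  both bounds.\<close>

lemma level_function_decreasing_weight:
  assumes lev: "level_function u uo"
  obtains k where "antimono k"
    "\<And>x. 0 < x \<Longrightarrow> primitive u x \<le> 2 * (\<integral>\<^sup>+t\<in>{0<..<x}. k t \<partial>lborel)"
    "\<And>x. 0 < x \<Longrightarrow> (\<integral>\<^sup>+t\<in>{0<..<x}. k t \<partial>lborel) \<le> 3 * primitive uo x"
proof (cases "\<exists>H. concave_majorant H (primitive u)")
  case True
  then obtain G where "least_concave_majorant G (primitive u)" and Gx: "\<And>x. 0 < x \<Longrightarrow> primitive uo x = ennreal (G x)"
    using lev unfolding level_function_def by auto
  then have G: "concave_on {0<..} G" and maj: "\<And>x. 0 < x \<Longrightarrow> enn2ereal (primitive u x) \<le> ereal (G x)"
    unfolding least_concave_majorant_def concave_majorant_def by auto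
  have G0: "0 \<le> G x" if "0 < x" for x
    using order_trans[OF enn2ereal_nonneg maj[OF that]] by simp
  have le: "primitive u x \<le> primitive uo x" if "0 < x" for x
    using maj[OF that] G0[OF that] unfolding Gx[OF that] less_eq_ennreal.rep_eq by simp
  have "weight uo" using lev unfolding level_function_def by simp
  then obtain v where v: "v \<in> borel_measurable borel" "AE t in lborel. 0 < t \<longrightarrow> uo t = v t"
    by (rule weight_obtain_borel)
  have P: "primitive uo x = (\<integral>\<^sup>+t\<in>{0<..<x}. v t \<partial>lborel)" for x
    unfolding primitive_def by (rule set_nn_integral_lebesgue_cong[OF v(2)]) auto
  obtain k where "antimono k"
    "\<And>x. 0 < x \<Longrightarrow> (\<integral>\<^sup>+s\<in>{0<..<x}. v s \<partial>lborel) \<le> 2 * (\<integral>\<^sup>+t\<in>{0<..<x}. k t \<partial>lborel)"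
    "\<And>x. 0 < x \<Longrightarrow> (\<integral>\<^sup>+t\<in>{0<..<x}. k t \<partial>lborel) \<le> 3 * (\<integral>\<^sup>+s\<in>{0<..<x}. v s \<partial>lborel)"
    using concave_primitive_decreasing_weight[OF v(1) G G0] Gx unfolding P by blast
  then show ?thesis using that[of k] le order_trans unfolding P by blast
next
  case False
  then have top: "primitive uo x = top" if "0 < x" for x
    using lev that unfolding level_function_def by auto
  have "(\<integral>\<^sup>+t\<in>{0<..<x}. top \<partial>lborel) = top" if "0 < x" for x :: real
    using that by (subst nn_integral_cmult_indicator) (auto simp: ennreal_top_mult)
  then show ?thesis
    using that[of "\<lambda>_. top"] top by (simp add: antimono_def ennreal_mult_top)
qed

theorem theorem5p1:
  fixes p p' q :: real and u uo w :: "real \<Rightarrow> ennreal"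
  assumes "1 < p" and "p \<le> q" and "2 \<le> q"
    and "1 / p + 1 / p' = 1"
    and "weight u" and "weight w"
    and "level_function u uo"
    and "(SUP x\<in>{0<..}. (\<integral>\<^sup>+t\<in>{0<..<1/x}. uo t \<partial>lebesgue) epowr (1 / q) *
                        (\<integral>\<^sup>+t\<in>{0<..<x}. w t epowr (1 - p') \<partial>lebesgue) epowr (1 / p')) < \<infinity>"
  shows "\<exists>C::real. C > 0 \<and>
           (\<forall>f :: real ^ 'n \<Rightarrow> complex. integrable lebesgue f \<longrightarrow>
              (\<integral>\<^sup>+t\<in>{0<..}. rearrangement (fourier f) t epowr q * u t \<partial>lebesgue) epowr (1 / q)
              \<le> ennreal C *
                (\<integral>\<^sup>+t\<in>{0<..}. rearrangement f t epowr p * w t \<partial>lebesgue) epowr (1 / p))"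
proof -
  define S where "S = (SUP x\<in>{0<..}. (\<integral>\<^sup>+t\<in>{0<..<1/x}. uo t \<partial>lebesgue) epowr (1 / q) *
                        (\<integral>\<^sup>+t\<in>{0<..<x}. w t epowr (1 - p') \<partial>lebesgue) epowr (1 / p'))"
  have S: "S < top" using assms(8) unfolding S_def by simp
  obtain v where v [measurable]: "v \<in> borel_measurable borel" and uv: "AE t in lborel. 0 < t \<longrightarrow> u t = v t"
    using weight_obtain_borel[OF assms(5)] .
  obtain z where z [measurable]: "z \<in> borel_measurable borel" and wz: "AE t in lborel. 0 < t \<longrightarrow> w t = z t"
    using weight_obtain_borel[OF assms(6)] .
  obtain k where k: "antimono k"
    and uk: "\<And>x. 0 < x \<Longrightarrow> primitive u x \<le> 2 * (\<integral>\<^sup>+t\<in>{0<..<x}. k t \<partial>lborel)"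
    and ku: "\<And>x. 0 < x \<Longrightarrow> (\<integral>\<^sup>+t\<in>{0<..<x}. k t \<partial>lborel) \<le> 3 * primitive uo x"
    using level_function_decreasing_weight[OF assms(7)] by blast
  note km [measurable] = borel_measurable_antimono_ennreal[OF k]
  \<comment> \<open>The factor 3 from the bound of \<open>k\<close> by the level function appears
    under the 1/q-th power; the summand 1 makes \<open>A\<close> positive.\<close>
  define A where "A = 3 powr (1 / q) * enn2real S + 1"
  have A: "0 < A" unfolding A_def by (intro add_nonneg_pos) auto
  have cond: "(\<integral>\<^sup>+t\<in>{0<..<1/x}. k t \<partial>lborel) epowr (1 / q) *
      (\<integral>\<^sup>+t\<in>{0<..<x}. z t epowr (1 - p') \<partial>lborel) epowr (1 / p') \<le> ennreal A" if x: "0 < x" for x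
  proof -
    have W: "(\<integral>\<^sup>+t\<in>{0<..<x}. w t epowr (1 - p') \<partial>lebesgue) = (\<integral>\<^sup>+t\<in>{0<..<x}. z t epowr (1 - p') \<partial>lborel)"
      by (rule set_nn_integral_lebesgue_cong) (use wz in \<open>auto elim: eventually_mono\<close>)
    have "(\<integral>\<^sup>+t\<in>{0<..<1/x}. k t \<partial>lborel) epowr (1 / q) \<le> (3 * primitive uo (1 / x)) epowr (1 / q)"
      using ku[of "1 / x"] x assms(3) by (intro epowr_mono) auto
    also have "\<dots> = ennreal (3 powr (1 / q)) * primitive uo (1 / x) epowr (1 / q)"
      using assms(3) ennreal_epowr[of 3 "1 / q"] by (simp add: epowr_mult)
    finally have "(\<integral>\<^sup>+t\<in>{0<..<1/x}. k t \<partial>lborel) epowr (1 / q) *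
        (\<integral>\<^sup>+t\<in>{0<..<x}. z t epowr (1 - p') \<partial>lborel) epowr (1 / p')
      \<le> ennreal (3 powr (1 / q)) * (primitive uo (1 / x) epowr (1 / q) *
        (\<integral>\<^sup>+t\<in>{0<..<x}. w t epowr (1 - p') \<partial>lebesgue) epowr (1 / p'))"
      unfolding W mult.assoc[symmetric] by (rule mult_right_mono) simp
    also have "\<dots> \<le> ennreal (3 powr (1 / q)) * S"
      unfolding S_def primitive_def using x by (intro mult_left_mono SUP_upper) auto
    also have "\<dots> = ennreal (3 powr (1 / q) * enn2real S)"
      using S by (simp add: ennreal_mult)
    also have "\<dots> \<le> ennreal A" unfolding A_def by (intro ennreal_leI) simp
    finally show ?thesis .
  qed
  \<comment> \<open>The outer 2 comes from replacing \<open>u\<close> by 2 k; the rest is the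
    constant for passing from squares to q-th powers with D = 6.\<close>
  define c where "c = 2 * (2 * (6 * (2 * 6) powr ((q - 2) / 2)))"
  have c: "0 < c" unfolding c_def by simp
  define C where "C = c powr (1 / q) * (8 * A)"
  have "(\<integral>\<^sup>+t\<in>{0<..}. rearrangement (fourier f) t epowr q * u t \<partial>lebesgue) epowr (1 / q)
      \<le> ennreal C * (\<integral>\<^sup>+t\<in>{0<..}. rearrangement f t epowr p * w t \<partial>lebesgue) epowr (1 / p)"
    if f: "integrable lebesgue f" for f :: "real ^ 'n \<Rightarrow> complex"
  proof -
    obtain g where g: "integrable lborel g" and fg: "rearrangement f = rearrangement g" "fourier f = fourier g"
      using lebesgue_integrable_obtain_borel[OF f] .
    have gm [measurable]: "g \<in> borel_measurable borel" using g by auto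
    define F where "F = rearrangement (fourier g)"
    define h where "h = rearrangement g"
    define Gf where "Gf t = (\<integral>\<^sup>+s\<in>{0<..<1/t}. h s \<partial>lborel)" for t
    have anti: "antimono F" "antimono h" unfolding F_def h_def by (rule antimono_rearrangement)+
    note [measurable] = anti[THEN borel_measurable_antimono_ennreal]
    \<comment> \<open>The condition on \<open>s\<close> is rewritten as one that is jointly
      measurable in (t, s), so measurability of the parametrised integral applies.\<close>
    have "Gf = (\<lambda>t. \<integral>\<^sup>+s. h s * indicator {s. 0 < s \<and> s < 1 / t} s \<partial>lborel)"
      unfolding Gf_def by (auto intro!: nn_integral_cong simp: indicator_def)
    then have [measurable]: "Gf \<in> borel_measurable borel" by simp
    have hfin: "(\<integral>\<^sup>+t\<in>{0<..}. h t \<partial>lborel) < top"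
      using nn_integral_rearrangement_diff[OF gm, of 0] g unfolding h_def by (simp add: integrable_iff_bounded)
    have "(\<integral>\<^sup>+t\<in>{0<..}. F t epowr q * u t \<partial>lebesgue) = (\<integral>\<^sup>+t\<in>{0<..}. F t epowr q * v t \<partial>lborel)"
      by (rule set_nn_integral_lebesgue_cong) (use uv in \<open>auto elim: eventually_mono\<close>)
    \<comment> \<open>Only primitives of \<open>u\<close> and \<open>k\<close> are comparable, not
      the weights themselves; Hardy's lemma suffices because F^q is decreasing.\<close>
    also have "\<dots> \<le> (\<integral>\<^sup>+t\<in>{0<..}. F t epowr q * (2 * k t) \<partial>lborel)"
    proof (rule nn_integral_antimono_mult_le)
      show "antimono (\<lambda>t. F t epowr q)"
        using assms(3) by (auto intro!: antimonoI epowr_mono antimonoD[OF anti(1)])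
      show "(\<integral>\<^sup>+t\<in>{0<..<x}. v t \<partial>lborel) \<le> (\<integral>\<^sup>+t\<in>{0<..<x}. 2 * k t \<partial>lborel)" if "0 < x" for x
      proof -
        have "primitive u x = (\<integral>\<^sup>+t\<in>{0<..<x}. v t \<partial>lborel)"
          unfolding primitive_def by (rule set_nn_integral_lebesgue_cong[OF uv]) auto
        then show ?thesis using uk[OF that] by (simp add: nn_integral_cmult mult.assoc)
      qed
    qed measurable
    also have "\<dots> = 2 * (\<integral>\<^sup>+t\<in>{0<..}. F t epowr q * k t \<partial>lborel)"
      by (subst nn_integral_cmult[symmetric]) (auto intro!: nn_integral_cong simp: mult_ac)
    also have "\<dots> \<le> 2 * (ennreal (2 * (6 * (2 * 6) powr ((q - 2) / 2))) * (\<integral>\<^sup>+t\<in>{0<..}. Gf t epowr q * k t \<partial>lborel))"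
    proof (intro mult_left_mono nn_integral_epowr_le_of_power2_le[OF assms(3) _ anti(1) _ k])
      show "F t \<le> ennreal ((LINT x|lborel. norm (g x)) + 1)" for t
        unfolding F_def by (rule rearrangement_fourier_bounded[OF g])
      show "(\<integral>\<^sup>+t\<in>{0<..<z}. (F t)\<^sup>2 \<partial>lborel) \<le> ennreal 6 * (\<integral>\<^sup>+t\<in>{0<..<z}. (Gf t)\<^sup>2 \<partial>lborel)" if "0 < z" for z
        using rearrangement_fourier_power2_le[OF g that] unfolding F_def Gf_def h_def by simp
    qed auto
    also have "\<dots> = ennreal c * (\<integral>\<^sup>+t\<in>{0<..}. Gf t epowr q * k t \<partial>lborel)"
      unfolding c_def by (subst (2) ennreal_mult) (auto simp: mult.assoc)
    \<comment> \<open>The exponent q/p on the right becomes 1/p once the 1/q-th power is taken at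
      the end.\<close>
    also have "\<dots> \<le> ennreal c * (ennreal (8 * A) epowr q * (\<integral>\<^sup>+t\<in>{0<..}. h t epowr p * z t \<partial>lborel) epowr (q / p))"
      unfolding Gf_def
      by (intro mult_left_mono weighted_Hardy_inequality[OF assms(1,2,4) A _ z km hfin cond]) auto
    also have "(\<integral>\<^sup>+t\<in>{0<..}. h t epowr p * z t \<partial>lborel) = (\<integral>\<^sup>+t\<in>{0<..}. h t epowr p * w t \<partial>lebesgue)"
      by (rule set_nn_integral_lebesgue_cong[symmetric]) (use wz in \<open>auto elim: eventually_mono\<close>)
    finally have "(\<integral>\<^sup>+t\<in>{0<..}. F t epowr q * u t \<partial>lebesgue) epowr (1 / q)
      \<le> (ennreal c * (ennreal (8 * A) epowr q * (\<integral>\<^sup>+t\<in>{0<..}. h t epowr p * w t \<partial>lebesgue) epowr (q / p))) epowr (1 / q)"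
      using assms(3) by (intro epowr_mono) auto
    also have "\<dots> = ennreal C * (\<integral>\<^sup>+t\<in>{0<..}. h t epowr p * w t \<partial>lebesgue) epowr (1 / p)"
      using assms(1,3) c A unfolding C_def
      by (simp add: epowr_mult epowr_epowr ennreal_epowr ennreal_mult powr_powr mult.assoc)
    finally show ?thesis unfolding fg F_def h_def .
  qed
  moreover have "0 < C" using c A unfolding C_def by simp
  ultimately show ?thesis by blast
qed

end
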